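(* Let $\mathbb{Z}_0:=\mathbb{Z}$ and $\mathbb{Z}_n:=\{z\in\mathbb{Z}\colon z/2\notin\mathbb{Z}\}$ for all $n\in\mathbb{N}=\{1,2,\ldots\}$, and let $\mu\colon\mathbb{R}^3\to\mathbb{R}^3$ and $B\in\mathbb{R}^3$ be given by $$\mu(x)=\begin{pmatrix}\displaystyle\sum_{n=0}^{\infty}\sum_{m\in\mathbb{Z}_n}\frac{1}{4^{(n+|m|)}}\cos\Big(\Big(x_3-\frac{m}{2^n}\Big)\exp\big([x_2]^3\big)\Big)\\0\\0\end{pmatrix},\qquad B=\begin{pmatrix}0\\1\\0\end{pmatrix}$$ for all $x=(x_1,x_2,x_3)\in\mathbb{R}^3$. Let $(\Omega,\mathcal{F},\mathbb{P})$ be a probability space, let $W\colon[0,\infty)\times\Omega\to\mathbb{R}$ be a one-dimensional standard Brownian motion, let $c,T\in(0,\infty)$, and let $X^x\colon[0,\infty)\times\Omega\to\mathbb{R}^3$, $x\in\mathbb{R}^3$, be solution processes with continuous sample paths of the SDE $dX^x(t)=\mu(X^x(t))\,dt+B\,dW(t)$, $t\in[0,\infty)$, with $X^x(0)=x$ for all $x\in\mathbb{R}^3$. Then for every $t\in(0,\infty)$ and every nonempty open set $O\subset\mathbb{R}^3$, the function $O\ni x\mapsto\mathbb{E}[X^x(t)]\in\mathbb{R}^3$ is continuous but not locally Hölder continuous. Moreover, there exists an infinitely often differentiable function $\varphi\colon\mathbb{R}^3\to\mathbb{R}$ with compact support such that for every $t\in(0,T]$ and every nonempty open set $O\subset(-c,c)^3$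 the function $O\ni x\mapsto\mathbb{E}[\varphi(X^x(t))]\in\mathbb{R}$ is continuous but not locally Hölder continuous.
   Context: A function is locally Hölder continuous if every point of its domain has a neighborhood on which it is Hölder continuous with some exponent in $(0,1]$. *)

theory Defs
  imports "HOL-Probability.Probability"
begin

definition Zset :: "nat \<Rightarrow> int set" where
  "Zset n = (if n = 0 then UNIV else {z. (of_int z / 2 :: real) \<notin> \<int>})"

(* Both sums converge absolutely: the (n, m) term is at most 4^(-n) * 4^(-|m|) in modulus. *)
definition drift :: "real ^ 3 \<Rightarrow> real ^ 3" where
  "drift x = vector
     [\<Sum>n. \<Sum>\<^sub>\<infinity>m\<in>Zset n. 1 / 4 ^ (n + nat \<bar>m\<bar>) * cos ((x $ 3 - of_int m / 2 ^ n) * exp ((x $ 2) ^ 3)),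
      0, 0]"

definition diffusion :: "real ^ 3" where
  "diffusion = vector [0, 1, 0]"

(* Only times in [0, \<infinity>) matter; values at negative times are unconstrained. *)
definition standard_brownian_motion :: "'w measure \<Rightarrow> (real \<Rightarrow> 'w \<Rightarrow> real) \<Rightarrow> bool" where
  "standard_brownian_motion M W \<longleftrightarrow>
     (\<forall>t\<ge>0. W t \<in> borel_measurable M) \<and>
     (AE \<omega> in M. W 0 \<omega> = 0) \<and>
     (\<forall>s t. 0 \<le> s \<and> s < t \<longrightarrow>
        distributed M lborel (\<lambda>\<omega>. W t \<omega> - W s \<omega>) (normal_density 0 (sqrt (t - s)))) \<and>
     (\<forall>(n::nat) (\<tau>::nat \<Rightarrow> real). 0 \<le> \<tau> 0 \<and> (\<forall>i<n. \<tau> i \<le> \<tau> (Suc i)) \<longrightarrow>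
        prob_space.indep_vars M (\<lambda>_. borel) (\<lambda>i \<omega>. W (\<tau> (Suc i)) \<omega> - W (\<tau> i) \<omega>) {..<n}) \<and>
     (AE \<omega> in M. continuous_on {0..} (\<lambda>t. W t \<omega>))"

(* Solution of dY(t) = \<mu>(Y(t)) dt + B dW(t) on [0, \<infinity>), Y(0) = x, with continuous sample paths,
   in integrated form.  Since B is a constant vector, the stochastic integral of B over [0, t] is
   (W(t) - W(0)) B.  The equation therefore makes sense path by path and no filtration or
   adaptedness condition is imposed. *)
definition sde_solution ::
  "'w measure \<Rightarrow> (real \<Rightarrow> 'w \<Rightarrow> real) \<Rightarrow> (real ^ 3 \<Rightarrow> real ^ 3) \<Rightarrow> real ^ 3 \<Rightarrow> real ^ 3 \<Rightarrow>
     (real \<Rightarrow> 'w \<Rightarrow> real ^ 3) \<Rightarrow> bool" where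
  "sde_solution M W \<mu> B x Y \<longleftrightarrow>
     (\<forall>t\<ge>0. Y t \<in> borel_measurable M) \<and>
     (\<forall>\<omega>\<in>space M. continuous_on {0..} (\<lambda>t. Y t \<omega>)) \<and>
     (AE \<omega> in M. Y 0 \<omega> = x) \<and>
     (AE \<omega> in M. \<forall>t\<ge>0.
        set_integrable lborel {0..t} (\<lambda>s. \<mu> (Y s \<omega>)) \<and>
        Y t \<omega> = x + (LINT s:{0..t}|lborel. \<mu> (Y s \<omega>)) + (W t \<omega> - W 0 \<omega>) *\<^sub>R B)"

definition holder_continuous_on ::
  "real \<Rightarrow> 'a::metric_space set \<Rightarrow> ('a \<Rightarrow> 'b::metric_space) \<Rightarrow> bool" where
  "holder_continuous_on \<alpha> S f \<longleftrightarrow>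
     (\<exists>C. \<forall>x\<in>S. \<forall>y\<in>S. dist (f x) (f y) \<le> C * dist x y powr \<alpha>)"

definition locally_holder_continuous_on ::
  "'a::metric_space set \<Rightarrow> ('a \<Rightarrow> 'b::metric_space) \<Rightarrow> bool" where
  "locally_holder_continuous_on S f \<longleftrightarrow>
     (\<forall>x\<in>S. \<exists>V. open V \<and> x \<in> V \<and> (\<exists>\<alpha>. 0 < \<alpha> \<and> \<alpha> \<le> 1 \<and> holder_continuous_on \<alpha> (S \<inter> V) f))"

(* The recursion runs over directional derivatives; in finite dimensions this is k-fold continuous
   differentiability. *)
fun times_cont_diff ::
  "nat \<Rightarrow> ('a::euclidean_space \<Rightarrow> 'b::real_normed_vector) \<Rightarrow> bool" where
  "times_cont_diff 0 f \<longleftrightarrow> continuous_on UNIV f"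
| "times_cont_diff (Suc k) f \<longleftrightarrow>
     (\<forall>x. f differentiable (at x)) \<and>
     (\<forall>v. times_cont_diff k (\<lambda>x. frechet_derivative f (at x) v))"

definition infinitely_differentiable ::
  "('a::euclidean_space \<Rightarrow> 'b::real_normed_vector) \<Rightarrow> bool" where
  "infinitely_differentiable f \<longleftrightarrow> (\<forall>k. times_cont_diff k f)"

definition has_compact_support :: "('a::topological_space \<Rightarrow> 'b::zero) \<Rightarrow> bool" where
  "has_compact_support f \<longleftrightarrow> compact (closure {x. f x \<noteq> 0})"

end

(* The second and third components of the solution are x2 + V(t) and x3, where V is W - W(0) up to a
   null set, so the first component is x1 plus the time integral of the drift along these.
   Take the symmetric second difference in x3 at a dyadic point z = m/2^n, with step y and with
   A = exp ((x2 + V(s))^3): the term of the drift centred at z contributes the expectation of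
   1 - cos (y A) > 0, and a term centred at distance d from z contributes that of
   cos (d A) (1 - cos (y A)).  For y = exp (-L^3) the former is at least of order
   exp (-C L^2) / L^2, since a Gaussian reaches height L with that probability; for d other than 0 the
   latter is of order exp (-L^3/8), because the cosine oscillates against a decreasing density.  All
   but finitely many terms are absorbed by pointwise domination, so the second difference exceeds
   every multiple of every power of y.  For the second claim, the factor in x2 of the test function
   is a bump that is a difference of two nonincreasing functions, and its factors in x1 and x3 are
   plateaus not seen by the process. *)

theory Submission
  imports Defs "HOL-Real_Asymp.Real_Asymp" "HOL-Computational_Algebra.Polynomial"
begin

section \<open>The drift series\<close>

text \<open>The dyadic centres accumulate at \<open>z\<close>, so their distances d become
  arbitrarily small, whereas the oscillatory estimate costs a factor 1/|d| and asks for y to be at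
  most |d|/2. It can serve only finitely many centres, chosen before y shrinks. The rest is harmless
  because 1 - cos (y A) is a nonnegative factor common to all terms of the second difference, and
  the total weight left over can be made at most half of the central weight. A first difference has
  no such common factor: it leaves products sin (d A) sin (y A), which 1 - cos (y A) does not
  dominate. The process has to be near height L at an intermediate time s, while the weight in x2 is
  evaluated at time t. For a weight of compact support the path must therefore come back between s
  and t, and the oscillation at time s must survive fixing the later increment. This is why the
  joint law at two times enters everywhere. Both excursions cost only a quadratic exponent in L; the
  cube in the drift is what leaves room between this cost and any power of y.\<close>

definition dterm :: "real \<Rightarrow> real \<Rightarrow> nat \<times> int \<Rightarrow> real" where
  "dterm v z = (\<lambda>(n, m). 1 / 4 ^ (n + nat \<bar>m\<bar>) * cos ((z - of_int m / 2 ^ n) * exp (v ^ 3)))"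

definition dweight :: "nat \<times> int \<Rightarrow> real" where
  "dweight = (\<lambda>(n, m). 1 / 4 ^ (n + nat \<bar>m\<bar>))"

text \<open>A single unconditional sum over pairs replaces the iterated sum in \<open>drift\<close>,
  so that any finite set of dyadic centres can be split off, whatever their levels.\<close>

definition dindex :: "(nat \<times> int) set" where
  "dindex = Sigma UNIV Zset"

definition drift1 :: "real \<Rightarrow> real \<Rightarrow> real" where
  "drift1 v z = (\<Sum>\<^sub>\<infinity>p\<in>dindex. dterm v z p)"

lemma summable_on_power_abs_int: "(\<lambda>m::int. (1/4::real) ^ nat \<bar>m\<bar>) summable_on UNIV"
proof -
  have s: "(\<lambda>n::nat. (1/4::real) ^ n) summable_on UNIV"
    by (subst summable_on_UNIV_nonneg_real_iff) (auto intro: summable_geometric)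
  have 1: "(\<lambda>m::int. (1/4::real) ^ nat \<bar>m\<bar>) summable_on range int"
    by (subst summable_on_reindex) (use s in \<open>auto simp: o_def\<close>)
  have "(\<lambda>m::int. (1/4::real) ^ nat \<bar>m\<bar>) summable_on range (\<lambda>n. - int n)"
    by (subst summable_on_reindex) (use s in \<open>auto simp: o_def inj_on_def\<close>)
  then have 2: "(\<lambda>m::int. (1/4::real) ^ nat \<bar>m\<bar>) summable_on (range (\<lambda>n. - int n) - range int)"
    by (rule summable_on_subset) auto
  have "range int \<union> (range (\<lambda>n. - int n) - range int) = UNIV"
  proof -
    have "m \<in> range int \<or> m \<in> range (\<lambda>n. - int n)" for m :: int
      by (metis int_cases2 rangeI)
    then show ?thesis by blast
  qed
  then show ?thesis
    using summable_on_Un_disjoint[OF 1 2] by auto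
qed

lemma summable_dweight: "dweight summable_on A"
proof -
  have s: "(\<lambda>n::nat. (1/4::real) ^ n) summable_on UNIV"
    by (subst summable_on_UNIV_nonneg_real_iff) (auto intro: summable_geometric)
  have "dweight summable_on (UNIV \<times> UNIV)"
  proof (rule summable_on_SigmaI)
    show "((\<lambda>m. dweight (n, m)) has_sum (1/4) ^ n * (\<Sum>\<^sub>\<infinity>m::int. (1/4) ^ nat \<bar>m\<bar>)) UNIV" for n
      using has_sum_cmult_right[OF has_sum_infsum[OF summable_on_power_abs_int], of "(1/4)^n"]
      by (simp add: dweight_def power_add power_divide)
    show "(\<lambda>n::nat. (1/4) ^ n * (\<Sum>\<^sub>\<infinity>m::int. (1/4::real) ^ nat \<bar>m\<bar>)) summable_on UNIV"
      using s by (rule summable_on_cmult_left)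
  qed (auto simp: dweight_def)
  then show ?thesis
    by (rule summable_on_subset) auto
qed

lemma dweight_pos: "0 < dweight p"
  by (auto simp: dweight_def split: prod.splits)

lemma dterm_eq: "dterm v z p = dweight p * cos ((z - of_int (snd p) / 2 ^ fst p) * exp (v ^ 3))"
  by (auto simp: dterm_def dweight_def split: prod.splits)

lemma abs_dterm_le: "\<bar>dterm v z p\<bar> \<le> dweight p"
  using dweight_pos[of p] by (auto simp: dterm_eq abs_mult intro!: mult_left_le)

lemma summable_dterm: "dterm v z summable_on A"
proof -
  have "(\<lambda>p. norm (dweight p)) summable_on A"
    using summable_dweight[of A] dweight_pos by (simp add: less_imp_le)
  then have "(\<lambda>p. norm (dterm v z p)) summable_on A"
    by (rule Infinite_Sum.abs_summable_on_comparison_test) (use abs_dterm_le dweight_pos in \<open>auto simp: less_imp_le\<close>)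
  then show ?thesis
    by (rule abs_summable_summable)
qed

text \<open>Absolute summability over pairs licenses summing over m first; the resulting function of
  n is summable, so its unconditional sum agrees with the ordinary series in
  \<open>drift\<close>.\<close>

lemma drift_nth: "drift x $ 1 = drift1 (x $ 2) (x $ 3)" "drift x $ 2 = 0" "drift x $ 3 = 0"
proof -
  define f where "f v z n = (\<Sum>\<^sub>\<infinity>m\<in>Zset n. dterm v z (n, m))" for v z n
  have "drift1 v z = (\<Sum>n. f v z n)" for v z
  proof -
    have "f v z summable_on UNIV"
      unfolding f_def
      by (rule summable_on_Sigma_banach) (use summable_dterm[of v z] in \<open>simp add: case_prod_unfold\<close>)
    then have "f v z sums (\<Sum>\<^sub>\<infinity>n. f v z n)"
      using has_sum_imp_sums has_sum_infsum by blast
    moreover have "(\<Sum>\<^sub>\<infinity>n. f v z n) = drift1 v z"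
      unfolding f_def drift1_def dindex_def by (rule infsum_Sigma_banach[OF summable_dterm])
    ultimately show ?thesis
      by (simp add: sums_iff)
  qed
  then show "drift x $ 1 = drift1 (x $ 2) (x $ 3)"
    by (simp add: drift_def f_def dterm_def)
qed (simp_all add: drift_def)

text \<open>A bound for the speed of the first component. Multiplied by \<open>T\<close> it also
  determines how wide the plateau of the test function in x1 has to be.\<close>

definition drift_bound :: real where "drift_bound = (\<Sum>\<^sub>\<infinity>p\<in>dindex. dweight p)"

lemma abs_drift1_le: "\<bar>drift1 v z\<bar> \<le> drift_bound"
proof -
  have abs: "(\<lambda>p. norm (dterm v z p)) summable_on dindex"
    using summable_dterm summable_on_iff_abs_summable_on_real by blast
  have "\<bar>drift1 v z\<bar> \<le> (\<Sum>\<^sub>\<infinity>p\<in>dindex. norm (dterm v z p))"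
    unfolding drift1_def using norm_infsum_bound[OF abs] by simp
  also have "\<dots> \<le> drift_bound"
    unfolding drift_bound_def by (rule infsum_mono[OF abs summable_dweight]) (use abs_dterm_le in auto)
  finally show ?thesis .
qed

lemma drift_bound_nonneg: "0 \<le> drift_bound"
  using abs_drift1_le[of 0 0] by linarith

lemma continuous_drift1: "continuous_on UNIV (\<lambda>(v, z). drift1 v z)"
proof (rule uniform_limit_theorem)
  show "uniform_limit UNIV (\<lambda>F (v, z). \<Sum>p\<in>F. dterm v z p) (\<lambda>(v, z). drift1 v z)
          (finite_subsets_at_top dindex)"
    using Weierstrass_m_test_general[of dindex UNIV "\<lambda>p (v, z). dterm v z p" dweight] abs_dterm_le
    by (auto simp: drift1_def case_prod_unfold summable_dweight)
  show "\<forall>\<^sub>F F in finite_subsets_at_top dindex. continuous_on UNIV (\<lambda>(v, z). \<Sum>p\<in>F. dterm v z p)"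
    unfolding dterm_eq case_prod_unfold
    by (intro always_eventually allI continuous_intros)
qed simp

lemma borel_measurable_drift1 [measurable (raw)]:
  assumes "f \<in> borel_measurable M" "g \<in> borel_measurable M"
  shows "(\<lambda>x. drift1 (f x) (g x)) \<in> borel_measurable M"
  using borel_measurable_continuous_Pair[OF assms] continuous_drift1 by (simp add: case_prod_unfold)

text \<open>The second symmetric difference of each term is
  \<open>-2 * dweight p * cos (d * A) * (1 - cos (y * A))\<close> with \<open>d\<close> the distance from \<open>z\<close> to the
  dyadic point of that term and \<open>A = exp (v ^ 3)\<close>.\<close>

lemma drift1_second_difference:
  assumes "m0 \<in> Zset n0" "z = of_int m0 / 2 ^ n0"
  shows "\<exists>F (d :: nat \<times> int \<Rightarrow> real) w0. finite F \<and> 0 < w0 \<and> (\<forall>p\<in>F. d p \<noteq> 0) \<and>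
    (\<forall>v y. (1 - cos (y * exp (v ^ 3))) * (w0 + 2 * (\<Sum>p\<in>F. dweight p * cos (d p * exp (v ^ 3))))
      \<le> 2 * drift1 v z - drift1 v (z + y) - drift1 v (z - y))"
proof -
  define p0 where "p0 = (n0, m0)"
  define d :: "nat \<times> int \<Rightarrow> real" where "d p = z - of_int (snd p) / 2 ^ fst p" for p
  have p0: "p0 \<in> dindex" "d p0 = 0"
    using assms by (auto simp: p0_def dindex_def d_def)
  \<comment> \<open>The tolerance is half the central weight: the second difference carries a factor
    2, so of twice this weight the tail uses up at most one share, and one share is left as the
    witness for \<open>w0\<close>.\<close>
  have "eventually (\<lambda>F. dist (sum dweight F) (infsum dweight dindex) < dweight p0 / 2)
          (finite_subsets_at_top dindex)"
    using infsum_tendsto[OF summable_dweight] dweight_pos[of p0] by (metis tendstoD half_gt_zero)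
  then obtain G0 where G0: "finite G0" "G0 \<subseteq> dindex"
    "\<And>F. finite F \<Longrightarrow> G0 \<subseteq> F \<Longrightarrow> F \<subseteq> dindex \<Longrightarrow>
       dist (sum dweight F) (infsum dweight dindex) < dweight p0 / 2"
    unfolding eventually_finite_subsets_at_top by metis
  define G where "G = insert p0 G0"
  define F where "F = {p \<in> G. d p \<noteq> 0}"
  have G: "finite G" "G \<subseteq> dindex" "p0 \<in> G"
    using G0 p0 by (auto simp: G_def)
  have tail: "infsum dweight (dindex - G) \<le> dweight p0 / 2"
  proof -
    have "dist (sum dweight G) (infsum dweight dindex) < dweight p0 / 2"
      using G0(3)[of G] G by (auto simp: G_def)
    moreover have "infsum dweight (dindex - G) = infsum dweight dindex - sum dweight G"
      using infsum_Diff[OF summable_dweight summable_dweight G(2)] G(1) by simp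
    ultimately show ?thesis unfolding dist_real_def by linarith
  qed
  have main: "(1 - cos (y * exp (v ^ 3))) *
              (dweight p0 + 2 * (\<Sum>p\<in>F. dweight p * cos (d p * exp (v ^ 3))))
            \<le> 2 * drift1 v z - drift1 v (z + y) - drift1 v (z - y)" for v y
  proof -
    define a where "a = exp (v ^ 3)"
    have t: "2 * dterm v z p - dterm v (z + y) p - dterm v (z - y) p =
        2 * (1 - cos (y * a)) * dterm v z p" for p
    proof -
      have e: "dterm v (z + y) p = dweight p * cos (d p * a + y * a)"
        "dterm v (z - y) p = dweight p * cos (d p * a - y * a)"
        "dterm v z p = dweight p * cos (d p * a)"
        by (simp_all add: dterm_eq a_def d_def algebra_simps)
      show ?thesis
        unfolding e cos_add cos_diff by (simp add: algebra_simps)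
    qed
    have "2 * drift1 v z - drift1 v (z + y) - drift1 v (z - y) = 2 * (1 - cos (y * a)) * drift1 v z"
    proof -
      have s: "(dterm v u has_sum drift1 v u) dindex" for u
        unfolding drift1_def by (rule has_sum_infsum[OF summable_dterm])
      have "((\<lambda>p. 2 * dterm v z p - dterm v (z + y) p - dterm v (z - y) p) has_sum
              (2 * drift1 v z - drift1 v (z + y) - drift1 v (z - y))) dindex"
        using has_sum_add[OF has_sum_add[OF has_sum_cmult_right[OF s, of 2 z]
              has_sum_cmult_right[OF s, of "-1" "z + y"]] has_sum_cmult_right[OF s, of "-1" "z - y"]]
        by simp
      moreover have "((\<lambda>p. 2 * (1 - cos (y * a)) * dterm v z p) has_sum
              2 * (1 - cos (y * a)) * drift1 v z) dindex"
        by (intro has_sum_cmult_right s)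
      ultimately show ?thesis
        unfolding t by (rule has_sum_unique)
    qed
    moreover have "dweight p0 / 2 + (\<Sum>p\<in>F. dweight p * cos (d p * a)) \<le> drift1 v z"
    proof -
      have "drift1 v z = sum (dterm v z) G + infsum (dterm v z) (dindex - G)"
        unfolding drift1_def using infsum_Diff[OF summable_dterm summable_dterm G(2), of v z] G(1) by simp
      moreover have "\<bar>infsum (dterm v z) (dindex - G)\<bar> \<le> dweight p0 / 2"
      proof -
        have abs: "(\<lambda>p. norm (dterm v z p)) summable_on (dindex - G)"
          using summable_dterm summable_on_iff_abs_summable_on_real by blast
        have "\<bar>infsum (dterm v z) (dindex - G)\<bar> \<le> (\<Sum>\<^sub>\<infinity>p\<in>dindex - G. norm (dterm v z p))"
          using norm_infsum_bound[OF abs] by simp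
        also have "\<dots> \<le> infsum dweight (dindex - G)"
          by (rule infsum_mono[OF abs summable_dweight]) (use abs_dterm_le in auto)
        finally show ?thesis using tail by simp
      qed
      moreover have "sum (dterm v z) G \<ge> dweight p0 + (\<Sum>p\<in>F. dweight p * cos (d p * a))"
      proof -
        \<comment> \<open>Terms of \<open>G\<close> centred at \<open>z\<close> itself have cosine
          1, hence a favourable sign, and only \<open>p0\<close> among them is kept in the lower
          bound. The centres off \<open>z\<close> make up \<open>F\<close>.\<close>
        have "sum (dterm v z) G = sum (dterm v z) {p \<in> G. d p = 0} + sum (dterm v z) F"
        proof -
          have "G = {p \<in> G. d p = 0} \<union> F" by (auto simp: F_def)
          then show ?thesis
            using sum.union_disjoint[of "{p \<in> G. d p = 0}" F "dterm v z"] G(1)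
            by (auto simp: F_def)
        qed
        moreover have "sum (dterm v z) F = (\<Sum>p\<in>F. dweight p * cos (d p * a))"
          by (simp add: dterm_eq a_def d_def)
        moreover have "sum (dterm v z) {p \<in> G. d p = 0} \<ge> dweight p0"
        proof -
          have "dweight p0 \<le> sum dweight {p \<in> G. d p = 0}"
            by (rule member_le_sum) (use G p0 dweight_pos in \<open>auto intro: less_imp_le\<close>)
          also have "\<dots> = sum (dterm v z) {p \<in> G. d p = 0}"
            by (intro sum.cong) (auto simp: dterm_eq d_def)
          finally show ?thesis .
        qed
        ultimately show ?thesis by linarith
      qed
      ultimately show ?thesis by linarith
    qed
    ultimately show ?thesis
      unfolding a_def[symmetric]
      using mult_left_mono[of "dweight p0 / 2 + (\<Sum>p\<in>F. dweight p * cos (d p * a))" "drift1 v z"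
          "2 * (1 - cos (y * a))"] cos_le_one[of "y * a"]
      by (simp add: algebra_simps)
  qed
  show ?thesis
  proof (intro exI conjI allI)
    show "finite F" "\<forall>p\<in>F. d p \<noteq> 0"
      using G(1) by (auto simp: F_def)
  qed (rule dweight_pos main)+
qed

section \<open>Oscillatory integrals and Gaussian densities\<close>

text \<open>Multiplying the cosine by the derivative of exp (v^3) gives a function with
  antiderivative of size 1/|e|, so its integral over any interval is at most 2/|e|. The compensating
  factor, \<open>\<rho>\<close> divided by that derivative, is monotone, and the second mean value
  theorem reduces the integral to two such pieces, whence the 4. At \<open>a\<close> the
  compensating factor supplies exp (-(a^3)), where 1 \<le> a allows 3 a^2 to be dropped.\<close>

lemma oscillatory_integral_bound_Icc:
  fixes \<rho> :: "real \<Rightarrow> real"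
  assumes ab: "1 \<le> a" "a \<le> b" and e: "e \<noteq> 0"
    and nonneg: "\<And>v. a \<le> v \<Longrightarrow> 0 \<le> \<rho> v"
    and anti: "\<And>u v. a \<le> u \<Longrightarrow> u \<le> v \<Longrightarrow> \<rho> v \<le> \<rho> u"
  shows "\<bar>integral {a..b} (\<lambda>v. cos (e * exp (v ^ 3)) * \<rho> v)\<bar> \<le> 4 * \<rho> a * exp (- (a ^ 3)) / \<bar>e\<bar>"
proof -
  \<comment> \<open>Both factors carry a minus sign: their product is unchanged, and
    \<open>g\<close> becomes nondecreasing, the form in which the second mean value theorem is
    applied.\<close>
  define f where "f v = - (cos (e * exp (v ^ 3)) * (3 * v\<^sup>2 * exp (v ^ 3)))" for v :: real
  define g where "g v = - (\<rho> v / (3 * v\<^sup>2 * exp (v ^ 3)))" for v :: real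
  have fi: "(f has_integral (- (sin (e * exp (d ^ 3)) / e) - (- (sin (e * exp (c ^ 3)) / e)))) {c..d}"
    if "c \<le> d" for c d
  proof (rule fundamental_theorem_of_calculus[OF that])
    fix x :: real
    have "((\<lambda>v. - (sin (e * exp (v ^ 3)) / e)) has_real_derivative f x) (at x within {c..d})"
      unfolding f_def by (rule derivative_eq_intros refl | use e in \<open>simp add: field_simps\<close>)+
    then show "((\<lambda>v. - (sin (e * exp (v ^ 3)) / e)) has_vector_derivative f x) (at x within {c..d})"
      by (simp add: has_real_derivative_iff_has_vector_derivative)
  qed
  have fb: "\<bar>integral {c..d} f\<bar> \<le> 2 / \<bar>e\<bar>" if "c \<le> d" for c d
  proof -
    have "\<bar>integral {c..d} f\<bar> = \<bar>sin (e * exp (c ^ 3)) - sin (e * exp (d ^ 3))\<bar> / \<bar>e\<bar>"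
      using integral_unique[OF fi[OF that]] by (simp add: abs_divide diff_divide_distrib[symmetric])
    also have "\<dots> \<le> 2 / \<bar>e\<bar>"
      by (intro divide_right_mono)
        (use abs_sin_le_one[of "e * exp (c ^ 3)"] abs_sin_le_one[of "e * exp (d ^ 3)"] in linarith, simp)
    finally show ?thesis .
  qed
  have gm: "g x \<le> g y" if "a \<le> x" "x \<le> y" for x y
  proof -
    have "3 * x\<^sup>2 * exp (x ^ 3) \<le> 3 * y\<^sup>2 * exp (y ^ 3)"
      using that ab by (intro mult_mono power_mono) (auto intro: power_mono)
    moreover have "0 < 3 * x\<^sup>2 * exp (x ^ 3)"
      using that ab by auto
    ultimately show ?thesis
      unfolding g_def using that anti[of x y] nonneg[of y] by (auto intro!: frac_le nonneg)
  qed
  have ga: "\<bar>g a\<bar> \<le> \<rho> a * exp (- (a ^ 3))"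
  proof -
    have "1 * exp (a ^ 3) \<le> 3 * a\<^sup>2 * exp (a ^ 3)"
      using ab one_le_power[OF ab(1), of 2] by (intro mult_right_mono exp_ge_zero) linarith
    then have "\<rho> a / (3 * a\<^sup>2 * exp (a ^ 3)) \<le> \<rho> a / exp (a ^ 3)"
      using nonneg[of a] ab by (intro divide_left_mono) auto
    then show ?thesis
      using nonneg[of a] by (simp add: g_def exp_minus field_simps)
  qed
  have gb: "\<bar>g b\<bar> \<le> \<bar>g a\<bar>"
  proof -
    have "g b \<le> 0" using nonneg[of b] ab by (auto simp: g_def)
    then show ?thesis using gm[of a b] ab by auto
  qed
  obtain c where c: "c \<in> {a..b}"
    "integral {a..b} (\<lambda>x. g x * f x) = g a * integral {a..c} f + g b * integral {c..b} f"
    using second_mean_value_theorem[of f a b g] fi[of a b] ab gm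
    by (metis has_integral_integrable)
  have "integral {a..b} (\<lambda>v. cos (e * exp (v ^ 3)) * \<rho> v) = integral {a..b} (\<lambda>x. g x * f x)"
    using ab by (intro Henstock_Kurzweil_Integration.integral_cong) (simp add: f_def g_def)
  also have "\<bar>\<dots>\<bar> \<le> \<bar>g a\<bar> * \<bar>integral {a..c} f\<bar> + \<bar>g b\<bar> * \<bar>integral {c..b} f\<bar>"
    unfolding c(2) by (rule order_trans[OF abs_triangle_ineq]) (simp add: abs_mult)
  also have "\<dots> \<le> \<bar>g a\<bar> * (2 / \<bar>e\<bar>) + \<bar>g a\<bar> * (2 / \<bar>e\<bar>)"
    using c(1) by (intro add_mono mult_mono fb gb) auto
  also have "\<dots> = 4 / \<bar>e\<bar> * \<bar>g a\<bar>"
    by simp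
  also have "\<dots> \<le> 4 / \<bar>e\<bar> * (\<rho> a * exp (- (a ^ 3)))"
    by (intro mult_left_mono ga) auto
  finally show ?thesis by (simp add: mult.assoc)
qed

text \<open>The substitution \<open>A = exp (v ^ 3)\<close> turns the cosine into one of constant frequency \<open>e\<close> against a
  decreasing amplitude, to which the second mean value theorem applies.\<close>

lemma oscillatory_integral_bound:
  fixes \<rho> :: "real \<Rightarrow> real"
  assumes a: "1 \<le> a" and e: "e \<noteq> 0"
    and nonneg: "\<And>v. a \<le> v \<Longrightarrow> 0 \<le> \<rho> v"
    and anti: "\<And>u v. a \<le> u \<Longrightarrow> u \<le> v \<Longrightarrow> \<rho> v \<le> \<rho> u"
    and int: "set_integrable lborel {a..} \<rho>"
    and meas: "\<rho> \<in> borel_measurable borel"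
  shows "\<bar>LINT v:{a..}|lborel. cos (e * exp (v ^ 3)) * \<rho> v\<bar> \<le> 4 * \<rho> a * exp (- (a ^ 3)) / \<bar>e\<bar>"
proof -
  let ?h = "\<lambda>v. cos (e * exp (v ^ 3)) * \<rho> v"
  note [measurable] = meas
  have i: "set_integrable lborel {a..} ?h"
    using int unfolding set_integrable_def
    by (rule Bochner_Integration.integrable_bound)
       (auto simp: abs_mult indicator_def intro!: mult_left_le_one_le)
  have "((\<lambda>b. LINT v:{a..b}|lborel. ?h v) \<longlongrightarrow> (LINT v:{a..}|lborel. ?h v)) at_top"
    by (rule tendsto_set_lebesgue_integral_at_top[OF _ i]) auto
  then have "((\<lambda>b. \<bar>LINT v:{a..b}|lborel. ?h v\<bar>) \<longlongrightarrow> \<bar>LINT v:{a..}|lborel. ?h v\<bar>) at_top"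
    by (rule tendsto_rabs)
  moreover have "\<forall>\<^sub>F b in at_top. \<bar>LINT v:{a..b}|lborel. ?h v\<bar> \<le> 4 * \<rho> a * exp (- (a ^ 3)) / \<bar>e\<bar>"
    using eventually_ge_at_top[of a]
  proof eventually_elim
    case (elim b)
    have "set_integrable lborel {a..b} ?h"
      by (rule set_integrable_subset[OF i]) auto
    then show ?case
      using oscillatory_integral_bound_Icc[of a b e \<rho>] a e nonneg anti elim
      by (simp add: set_borel_integral_eq_integral)
  qed
  ultimately show ?thesis
    by (rule tendsto_upperbound) simp
qed

section \<open>Gaussian density bounds, the cosine gap and the comparison of rates\<close>

lemma normal_density_antimono:
  assumes "0 < s" "0 \<le> u" "u \<le> v"
  shows "normal_density 0 s v \<le> normal_density 0 s u"
proof -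
  have "u\<^sup>2 \<le> v\<^sup>2"
    using assms by (intro power_mono) auto
  then show ?thesis
    unfolding normal_density_def using assms
    by (intro mult_left_mono) (auto simp: divide_right_mono)
qed

text \<open>At distance at least 1 from the mean the density stays bounded even as the variance
  tends to 0, since exp (-1/(2 s^2)) beats 1/s. The oscillatory estimate thus becomes uniform over
  all times s, at the price of the condition x + 1 \<le> a.\<close>

lemma normal_density_le_one:
  assumes s: "0 < s" and u: "1 \<le> u"
  shows "normal_density 0 s u \<le> 1"
proof -
  have "normal_density 0 s u \<le> normal_density 0 s 1"
    using normal_density_antimono[of s 1 u] assms by auto
  also have "\<dots> \<le> 1"
  proof -
    have "1 + 1 / (2 * s\<^sup>2) \<le> exp (1 / (2 * s\<^sup>2))"
      by (rule exp_ge_add_one_self)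
    then have "exp (- (1 / (2 * s\<^sup>2))) \<le> 1 / (1 + 1 / (2 * s\<^sup>2))"
      unfolding exp_minus inverse_eq_divide using s
      by (intro divide_left_mono) (auto intro!: mult_pos_pos add_pos_pos)
    also have "\<dots> = 2 * s\<^sup>2 / (2 * s\<^sup>2 + 1)"
      using s by (simp add: field_simps)
    also have "\<dots> \<le> s"
    proof -
      \<comment> \<open>The square is completed in 2 s^2 - 2 s + 1, the factor left over from s (2
        s^2 + 1) - 2 s^2.\<close>
      have "0 \<le> s * (2 * (s - 1/2)\<^sup>2 + 1/2)"
        using s by (intro mult_nonneg_nonneg) auto
      moreover have "0 < 2 * s\<^sup>2 + 1"
        by (simp add: add_nonneg_pos)
      ultimately show ?thesis
        by (simp add: pos_divide_le_eq power2_eq_square algebra_simps)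
    qed
    also have "s \<le> sqrt (2 * pi * s\<^sup>2)"
    proof (rule real_le_rsqrt)
      have "1 * s\<^sup>2 \<le> (2 * pi) * s\<^sup>2"
        using pi_ge_two by (intro mult_right_mono) auto
      then show "s\<^sup>2 \<le> 2 * pi * s\<^sup>2" by simp
    qed
    finally show ?thesis
      using s by (simp add: normal_density_def divide_le_eq)
  qed
  finally show ?thesis .
qed

text \<open>The exponent is taken at the smallest variance t/4 and the prefactor at the largest
  variance t, so one constant serves both increments when s runs through [t/4, t/2].\<close>

lemma normal_density_lower:
  assumes s: "t / 4 \<le> s" "s \<le> t" "0 < t" and u: "\<bar>u\<bar> \<le> K"
  shows "exp (- (2 * K\<^sup>2 / t)) / sqrt (2 * pi * t) \<le> normal_density 0 (sqrt s) u"
proof -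
  have s0: "0 < s" using s by auto
  have "u\<^sup>2 \<le> K\<^sup>2"
    using power_mono[OF u, of 2] by simp
  then have "u\<^sup>2 / (2 * s) \<le> K\<^sup>2 / (t / 2)"
    using s s0 by (intro frac_le) auto
  then have 1: "exp (- (2 * K\<^sup>2 / t)) \<le> exp (- u\<^sup>2 / (2 * s))"
    by (simp add: field_simps)
  have "sqrt (2 * pi * s) \<le> sqrt (2 * pi * t)"
    using s by auto
  then have "exp (- (2 * K\<^sup>2 / t)) / sqrt (2 * pi * t) \<le> exp (- u\<^sup>2 / (2 * s)) / sqrt (2 * pi * s)"
    using s0 by (intro frac_le 1) auto
  then show ?thesis
    using s0 by (simp add: normal_density_def)
qed

abbreviation gauss :: "real \<Rightarrow> real measure" where
  "gauss s \<equiv> density lborel (normal_density 0 (sqrt s))"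

lemma measure_gauss_Icc_ge:
  assumes s: "t / 4 \<le> s" "s \<le> t" "0 < t" and pq: "p \<le> q" and K: "\<bar>p\<bar> \<le> K" "\<bar>q\<bar> \<le> K"
  shows "(q - p) * (exp (- (2 * K\<^sup>2 / t)) / sqrt (2 * pi * t)) \<le> measure (gauss s) {p..q}"
proof -
  interpret prob_space "gauss s"
    using s by (intro prob_space_normal_density) auto
  define m where "m = exp (- (2 * K\<^sup>2 / t)) / sqrt (2 * pi * t)"
  have m: "0 \<le> m" using s by (auto simp: m_def)
  have "ennreal ((q - p) * m) = (\<integral>\<^sup>+u. ennreal m * indicator {p..q} u \<partial>lborel)"
    using pq m by (simp add: nn_integral_cmult_indicator ennreal_mult' mult.commute)
  also have "\<dots> \<le> (\<integral>\<^sup>+u. ennreal (normal_density 0 (sqrt s) u) * indicator {p..q} u \<partial>lborel)"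
    using normal_density_lower[OF s, of _ K] K
    by (intro nn_integral_mono) (auto simp: m_def indicator_def intro!: ennreal_leI)
  also have "\<dots> = emeasure (gauss s) {p..q}"
    by (subst emeasure_density) auto
  finally show ?thesis
    using m by (simp add: m_def[symmetric] emeasure_eq_measure pq)
qed

text \<open>The range [exp (-1), 1] is that of the phase y exp (v^3) when v^3 lies within 1 below
  L^3.\<close>

lemma cos_gap:
  assumes "exp (-1) \<le> \<theta>" "\<theta> \<le> (1::real)"
  shows "1 - cos (exp (-1)) \<le> 1 - cos \<theta>"
proof -
  have "cos \<theta> \<le> cos (exp (-1))"
    using assms pi_gt3 by (intro cos_monotone_0_pi_le) auto
  then show ?thesis by simp
qed

lemma cos_gap_pos: "0 < 1 - cos (exp (-1::real))"
proof -
  have "exp (-1::real) \<le> pi"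
    using pi_gt3 exp_le_one_iff[of "-1::real"] by linarith
  then show ?thesis
    using cos_monotone_0_pi[of 0 "exp (-1::real)"] by auto
qed

lemma one_minus_cos_le: "1 - cos (\<theta>::real) \<le> \<theta>\<^sup>2 / 2"
proof -
  have "1 - cos \<theta> = 2 * (sin (\<theta> / 2))\<^sup>2"
    using cos_double_sin[of "\<theta> / 2"] by simp
  also have "\<dots> \<le> 2 * (\<theta> / 2)\<^sup>2"
    using abs_sin_x_le_abs_x[of "\<theta> / 2"] by (intro mult_left_mono) (auto simp only: abs_le_square_iff)
  finally show ?thesis by (simp add: power_divide)
qed

text \<open>The left side will collect both the Hoelder bound C y^\<alpha> and the oscillatory
  errors; the right side is the Gaussian cost of the two excursions. A cubic exponent outweighs a
  quadratic one together with the factor 1/L^2, whatever the constants.\<close>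

lemma lower_dominates:
  fixes c1 c2 K t \<beta> :: real
  assumes "0 < c1" "0 < t" "0 < \<beta>"
  shows "\<forall>\<^sub>F L in at_top. c2 * exp (- (\<beta> * L ^ 3)) < c1 / L\<^sup>2 * exp (- (4 * (L + K)\<^sup>2 / t))"
proof -
  have "((\<lambda>L. c2 * exp (- (\<beta> * L ^ 3)) / (c1 / L\<^sup>2 * exp (- (4 * (L + K)\<^sup>2 / t)))) \<longlongrightarrow> 0) at_top"
    using assms by real_asymp
  then have "\<forall>\<^sub>F L in at_top. c2 * exp (- (\<beta> * L ^ 3)) / (c1 / L\<^sup>2 * exp (- (4 * (L + K)\<^sup>2 / t))) < 1"
    by (rule order_tendstoD) simp
  then show ?thesis
    using eventually_gt_at_top[of 0]
    by eventually_elim (use assms in \<open>simp add: divide_less_eq less_divide_eq\<close>)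
qed

lemma antimono_borel_measurable:
  fixes \<eta> :: "real \<Rightarrow> real"
  assumes "antimono \<eta>"
  shows "\<eta> \<in> borel_measurable borel"
proof -
  have "(\<lambda>u. - \<eta> u) \<in> borel_measurable borel"
    using assms by (intro borel_measurable_mono) (auto simp: mono_def antimono_def)
  then show ?thesis by simp
qed

section \<open>Expectations along Gaussian increments\<close>

text \<open>The noise enters the estimates through its joint law at two times and through joint
  measurability, which Fubini over time and probability requires. The theorem instantiates
  \<open>V\<close> by a component of a solution.\<close>

locale gaussian_increments = prob_space M for M :: "'w measure" +
  fixes V :: "real \<Rightarrow> 'w \<Rightarrow> real"
  assumes V_measurable: "(\<lambda>(s, \<omega>). V s \<omega>) \<in> borel_measurable (borel \<Otimes>\<^sub>M M)"
    and law: "\<And>s t. 0 < s \<Longrightarrow> s < t \<Longrightarrow>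
      distr M (borel \<Otimes>\<^sub>M borel) (\<lambda>\<omega>. (V s \<omega>, V t \<omega> - V s \<omega>)) = gauss s \<Otimes>\<^sub>M gauss (t - s)"
begin

lemma measurable_V [measurable (raw)]:
  assumes "f \<in> borel_measurable N" "g \<in> N \<rightarrow>\<^sub>M M"
  shows "(\<lambda>x. V (f x) (g x)) \<in> borel_measurable N"
  using measurable_compose[OF measurable_Pair[OF assms] V_measurable] by simp

text \<open>The later increment is put into the outer integral: for each fixed \<open>z\<close> the
  inner one is then a Lebesgue integral in \<open>u\<close> against an explicit density, to which
  oscillatory bounds apply.\<close>

lemma expectation_increments:
  assumes "0 < s" "s < t" and [measurable]: "G \<in> borel_measurable (borel \<Otimes>\<^sub>M borel)"
    and bound: "\<And>p. \<bar>G p\<bar> \<le> (C::real)"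
  shows "expectation (\<lambda>\<omega>. G (V s \<omega>, V t \<omega> - V s \<omega>)) =
    (\<integral>z. (\<integral>u. normal_density 0 (sqrt s) u * G (u, z) \<partial>lborel) \<partial>gauss (t - s))"
proof -
  interpret N1: prob_space "gauss s" using assms by (intro prob_space_normal_density) auto
  interpret N2: prob_space "gauss (t - s)" using assms by (intro prob_space_normal_density) auto
  interpret N: pair_prob_space "gauss s" "gauss (t - s)" ..
  have Gm: "G \<in> borel_measurable (gauss s \<Otimes>\<^sub>M gauss (t - s))"
    using assms(3) measurable_cong_sets[OF sets_pair_measure_cong, of "gauss s" borel "gauss (t - s)" borel
        "borel :: real measure" borel] by simp
  have "expectation (\<lambda>\<omega>. G (V s \<omega>, V t \<omega> - V s \<omega>)) =
      integral\<^sup>L (distr M (borel \<Otimes>\<^sub>M borel) (\<lambda>\<omega>. (V s \<omega>, V t \<omega> - V s \<omega>))) G"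
    by (rule integral_distr[symmetric]) measurable
  also have "\<dots> = integral\<^sup>L (gauss s \<Otimes>\<^sub>M gauss (t - s)) G"
    using assms by (simp add: law)
  also have "\<dots> = (\<integral>z. (\<integral>u. G (u, z) \<partial>gauss s) \<partial>gauss (t - s))"
  proof -
    have "integrable (gauss s \<Otimes>\<^sub>M gauss (t - s)) G"
      by (rule N.integrable_const_bound[where B = C]) (use bound Gm in auto)
    then show ?thesis
      using N.integral_snd[of "\<lambda>x y. G (x, y)"] by (simp add: case_prod_unfold)
  qed
  also have "\<dots> = (\<integral>z. (\<integral>u. normal_density 0 (sqrt s) u * G (u, z) \<partial>lborel) \<partial>gauss (t - s))"
  proof -
    have "(\<integral>u. G (u, z) \<partial>gauss s) = (\<integral>u. normal_density 0 (sqrt s) u * G (u, z) \<partial>lborel)" for z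
      using integral_density[of "\<lambda>u. G (u, z)" lborel "normal_density 0 (sqrt s)"] by simp
    then show ?thesis by simp
  qed
  finally show ?thesis .
qed

text \<open>Conditionally on \<open>V t - V s\<close> the law of \<open>V s\<close>, weighted by a nonincreasing cutoff, still has a
  nonincreasing density on \<open>[a, \<infinity>)\<close>.\<close>

lemma expectation_oscillatory_le:
  assumes st: "0 < s" "s < t" and e: "e \<noteq> 0" and a: "1 \<le> a" "x + 1 \<le> a"
    and \<eta>: "antimono \<eta>" "\<And>u. 0 \<le> \<eta> u" "\<And>u. \<eta> u \<le> (1::real)"
  shows "\<bar>expectation (\<lambda>\<omega>. indicator {a..} (x + V s \<omega>) * cos (e * exp ((x + V s \<omega>) ^ 3)) *
            \<eta> (x + V t \<omega>))\<bar> \<le> 4 * exp (- (a ^ 3)) / \<bar>e\<bar>"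
proof -
  note [measurable] = antimono_borel_measurable[OF \<eta>(1)]
  define p where "p = normal_density 0 (sqrt s)"
  define G where "G = (\<lambda>(u, z). indicator {a..} (x + u) * cos (e * exp ((x + u) ^ 3)) * \<eta> (x + u + z))"
  have Gm: "G \<in> borel_measurable (borel \<Otimes>\<^sub>M borel)"
    unfolding G_def by measurable
  have Gb: "\<bar>G q\<bar> \<le> 1" for q
    using \<eta>(2,3) by (auto simp: G_def abs_mult indicator_def split: prod.splits intro!: mult_le_one)
  interpret N2: prob_space "gauss (t - s)" using st by (intro prob_space_normal_density) auto
  define c where "c = 4 * exp (- (a ^ 3)) / \<bar>e\<bar>"
  have inner: "\<bar>\<integral>u. p u * G (u, z) \<partial>lborel\<bar> \<le> c" for z
  proof -
    \<comment> \<open>After the shift v = x + u the amplitude is a product of two factors that are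
      nonnegative and nonincreasing on v \<ge> a: the cutoff translated by \<open>z\<close>, and the
      density, because a lies to the right of its centre x.\<close>
    define \<rho> where "\<rho> v = \<eta> (v + z) * p (v - x)" for v
    have p0: "0 \<le> p u" for u by (simp add: p_def)
    have "(\<integral>u. p u * G (u, z) \<partial>lborel) = (\<integral>v. p (v - x) * G (v - x, z) \<partial>lborel)"
      using lborel_integral_real_affine[of 1 "\<lambda>u. p u * G (u, z)" "- x"] by simp
    also have "\<dots> = (LINT v:{a..}|lborel. cos (e * exp (v ^ 3)) * \<rho> v)"
      unfolding set_lebesgue_integral_def
      by (intro Bochner_Integration.integral_cong) (auto simp: G_def \<rho>_def)
    also have "\<bar>\<dots>\<bar> \<le> 4 * \<rho> a * exp (- (a ^ 3)) / \<bar>e\<bar>"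
    proof (rule oscillatory_integral_bound)
      show "0 \<le> \<rho> v" for v
        using \<eta>(2) p0 by (simp add: \<rho>_def)
      show "\<rho> v \<le> \<rho> u" if "a \<le> u" "u \<le> v" for u v
        unfolding \<rho>_def p_def using that a st \<eta> p0
        by (intro mult_mono normal_density_antimono) (auto simp: antimono_def)
      have "integrable lborel (\<lambda>v. p (- x + 1 * v))"
        unfolding p_def using st by (intro lborel_integrable_real_affine) auto
      then have int: "integrable lborel (\<lambda>v. p (v - x))" by simp
      show "set_integrable lborel {a..} \<rho>"
        unfolding set_integrable_def
        by (rule Bochner_Integration.integrable_bound[OF int])
          (use \<eta>(2,3) p0 in \<open>auto simp: \<rho>_def p_def indicator_def abs_mult intro!: mult_left_le_one_le\<close>)
      show "\<rho> \<in> borel_measurable borel"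
        unfolding \<rho>_def p_def by measurable
    qed (use a e in auto)
    also have "\<dots> \<le> c"
    proof -
      have "\<rho> a \<le> 1 * 1"
        unfolding \<rho>_def p_def using \<eta>(2,3) st a by (intro mult_mono normal_density_le_one) auto
      then show ?thesis
        by (auto simp: c_def intro!: divide_right_mono mult_right_mono)
    qed
    finally show ?thesis .
  qed
  have "expectation (\<lambda>\<omega>. indicator {a..} (x + V s \<omega>) * cos (e * exp ((x + V s \<omega>) ^ 3)) *
            \<eta> (x + V t \<omega>)) = expectation (\<lambda>\<omega>. G (V s \<omega>, V t \<omega> - V s \<omega>))"
    by (simp add: G_def)
  also have "\<dots> = (\<integral>z. (\<integral>u. p u * G (u, z) \<partial>lborel) \<partial>gauss (t - s))"
    unfolding p_def by (rule expectation_increments[OF st Gm Gb])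
  also have "\<bar>\<dots>\<bar> \<le> (\<integral>z. \<bar>\<integral>u. p u * G (u, z) \<partial>lborel\<bar> \<partial>gauss (t - s))"
    by (rule integral_abs_bound)
  also have "\<dots> \<le> (\<integral>z. c \<partial>gauss (t - s))"
  proof (rule integral_mono')
    show "integrable (gauss (t - s)) (\<lambda>z. c)" by simp
  qed (use inner in \<open>auto simp: c_def\<close>)
  also have "\<dots> = c"
    using N2.prob_space by simp
  finally show ?thesis by (simp add: c_def)
qed

text \<open>The scale \<open>y = exp (- (L ^ 3))\<close> is the one at which \<open>y * exp (v ^ 3)\<close> reaches \<open>1\<close> when
  \<open>v = L\<close>.\<close>

lemma expectation_off_peak_le:
  assumes st: "0 < s" "s < t" and d: "d \<noteq> 0" and y: "y = exp (- (L ^ 3))" "y \<le> \<bar>d\<bar> / 2"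
    and L: "2 \<le> L" "2 * (x + 1) \<le> L"
    and \<eta>: "antimono \<eta>" "\<And>u. 0 \<le> \<eta> u" "\<And>u. \<eta> u \<le> (1::real)"
  shows "\<bar>expectation (\<lambda>\<omega>. cos (d * exp ((x + V s \<omega>) ^ 3)) * (1 - cos (y * exp ((x + V s \<omega>) ^ 3))) *
            \<eta> (x + V t \<omega>))\<bar> \<le> (12 / \<bar>d\<bar> + 1 / 2) * exp (- (1 / 8 * L ^ 3))"
proof -
  note [measurable] = antimono_borel_measurable[OF \<eta>(1)]
  have \<eta>a: "\<bar>\<eta> u\<bar> \<le> 1" for u using \<eta>(2,3)[of u] by auto
  \<comment> \<open>Halving the height balances the two regimes: above L/2 the oscillation gives exp
    (-(L^3)/8), and below it the phase y A is at most exp (-7/8 L^3), so 1 - cos (y A) is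
    negligible.\<close>
  define a where "a = L / 2"
  have a: "1 \<le> a" "x + 1 \<le> a" using L by (auto simp: a_def)
  have a3: "a ^ 3 = 1 / 8 * L ^ 3" by (simp add: a_def power_divide)
  define A where "A \<omega> = exp ((x + V s \<omega>) ^ 3)" for \<omega>
  have [measurable]: "A \<in> borel_measurable M" unfolding A_def by measurable
  define I where "I e \<omega> = indicator {a..} (x + V s \<omega>) * cos (e * A \<omega>) * \<eta> (x + V t \<omega>)" for e \<omega>
  define J where "J \<omega> = indicator {..<a} (x + V s \<omega>) * cos (d * A \<omega>) * (1 - cos (y * A \<omega>)) *
    \<eta> (x + V t \<omega>)" for \<omega>
  have [measurable]: "I e \<in> borel_measurable M" "J \<in> borel_measurable M" for e
    unfolding I_def[abs_def] J_def[abs_def] by measurable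
  have Ib: "\<bar>I e \<omega>\<bar> \<le> 1" for e \<omega>
    using \<eta>a by (auto simp: I_def abs_mult indicator_def intro!: mult_le_one)
  have Jb: "\<bar>J \<omega>\<bar> \<le> 1 / 2 * exp (- (1 / 8 * L ^ 3))" for \<omega>
  proof (cases "x + V s \<omega> < a")
    case True
    then have "(x + V s \<omega>) ^ 3 \<le> a ^ 3"
      by (intro power_mono_odd) auto
    then have "A \<omega> \<le> exp (1 / 8 * L ^ 3)"
      by (simp add: A_def a3)
    then have "y * A \<omega> \<le> exp (- (L ^ 3)) * exp (1 / 8 * L ^ 3)"
      using y by (auto intro: mult_left_mono)
    also have "\<dots> = exp (- (7 / 8 * L ^ 3))"
      by (simp add: exp_add[symmetric])
    finally have yA: "y * A \<omega> \<le> exp (- (7 / 8 * L ^ 3))" .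
    have "1 - cos (y * A \<omega>) \<le> (y * A \<omega>)\<^sup>2 / 2"
      by (rule one_minus_cos_le)
    also have "\<dots> \<le> (exp (- (7 / 8 * L ^ 3)))\<^sup>2 / 2"
      using yA y by (intro divide_right_mono power_mono) (auto simp: A_def)
    also have "\<dots> = 1 / 2 * exp (- (7 / 4 * L ^ 3))"
      by (simp add: power2_eq_square exp_add[symmetric])
    also have "\<dots> \<le> 1 / 2 * exp (- (1 / 8 * L ^ 3))"
      using L by auto
    finally have *: "1 - cos (y * A \<omega>) \<le> 1 / 2 * exp (- (1 / 8 * L ^ 3))" .
    have "\<bar>J \<omega>\<bar> = (\<bar>cos (d * A \<omega>)\<bar> * \<bar>\<eta> (x + V t \<omega>)\<bar>) * (1 - cos (y * A \<omega>))"
      using True by (simp add: J_def abs_mult mult_ac)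
    also have "\<dots> \<le> 1 * (1 - cos (y * A \<omega>))"
      using \<eta>a by (intro mult_right_mono mult_le_one) auto
    finally show ?thesis using * by simp
  qed (auto simp: J_def)
  have Ii: "integrable M (I e)" for e
    by (rule integrable_const_bound[where B = 1]) (use Ib in auto)
  have Ji: "integrable M J"
    by (rule integrable_const_bound[where B = "1 / 2 * exp (- (1 / 8 * L ^ 3))"]) (use Jb in auto)
  \<comment> \<open>Above the threshold, cos (d A) cos (y A) is half the sum of cosines at the
    frequencies d + y and d - y. The condition y \<le> |d|/2 keeps both at least |d|/2 in modulus,
    so the three bounds 4/|d|, 8/|d| and 8/|d| combine with coefficients 1, 1/2, 1/2 to 12/|d|;
    \<open>J\<close> adds the 1/2.\<close>
  have split: "cos (d * A \<omega>) * (1 - cos (y * A \<omega>)) * \<eta> (x + V t \<omega>) =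
      I d \<omega> - 1 / 2 * I (d + y) \<omega> - 1 / 2 * I (d - y) \<omega> + J \<omega>" for \<omega>
  proof -
    have "cos ((d + y) * A \<omega>) = cos (d * A \<omega> + y * A \<omega>)" "cos ((d - y) * A \<omega>) = cos (d * A \<omega> - y * A \<omega>)"
      by (simp_all add: algebra_simps)
    then show ?thesis
      unfolding I_def J_def by (auto simp: cos_add cos_diff indicator_def algebra_simps)
  qed
  have y0: "0 < y" using y by simp
  have dy: "\<bar>d\<bar> / 2 \<le> \<bar>d + y\<bar>" "\<bar>d\<bar> / 2 \<le> \<bar>d - y\<bar>"
    using y(2) y0 by linarith+
  have I: "\<bar>expectation (I e)\<bar> \<le> 4 * exp (- (1 / 8 * L ^ 3)) / \<bar>e\<bar>" if "e \<noteq> 0" for e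
    using expectation_oscillatory_le[OF st that a \<eta>] unfolding I_def A_def a3 by simp
  have I2: "\<bar>expectation (I e)\<bar> \<le> 8 * exp (- (1 / 8 * L ^ 3)) / \<bar>d\<bar>" if "\<bar>d\<bar> / 2 \<le> \<bar>e\<bar>" for e
  proof -
    have e: "e \<noteq> 0" using that d by auto
    have "4 * exp (- (1 / 8 * L ^ 3)) / \<bar>e\<bar> \<le> 4 * exp (- (1 / 8 * L ^ 3)) / (\<bar>d\<bar> / 2)"
      using that d by (intro divide_left_mono) auto
    then show ?thesis using I[OF e] by simp
  qed
  have J: "\<bar>expectation J\<bar> \<le> 1 / 2 * exp (- (1 / 8 * L ^ 3))"
  proof -
    have "\<bar>expectation J\<bar> \<le> expectation (\<lambda>\<omega>. \<bar>J \<omega>\<bar>)" by (rule integral_abs_bound)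
    also have "\<dots> \<le> expectation (\<lambda>\<omega>. 1 / 2 * exp (- (1 / 8 * L ^ 3)))"
      using Ji Jb by (intro integral_mono) auto
    finally show ?thesis by (simp add: prob_space)
  qed
  have "expectation (\<lambda>\<omega>. cos (d * A \<omega>) * (1 - cos (y * A \<omega>)) * \<eta> (x + V t \<omega>)) =
      expectation (I d) - 1 / 2 * expectation (I (d + y)) - 1 / 2 * expectation (I (d - y)) + expectation J"
    unfolding split using Ii Ji by simp
  moreover have "\<bar>expectation (I d)\<bar> \<le> 4 * (exp (- (1 / 8 * L ^ 3)) / \<bar>d\<bar>)"
    "\<bar>expectation (I (d + y))\<bar> \<le> 8 * (exp (- (1 / 8 * L ^ 3)) / \<bar>d\<bar>)"
    "\<bar>expectation (I (d - y))\<bar> \<le> 8 * (exp (- (1 / 8 * L ^ 3)) / \<bar>d\<bar>)"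
    using I[OF d] I2[OF dy(1)] I2[OF dy(2)] by simp_all
  moreover have "(12 / \<bar>d\<bar> + 1 / 2) * exp (- (1 / 8 * L ^ 3)) =
      12 * (exp (- (1 / 8 * L ^ 3)) / \<bar>d\<bar>) + 1 / 2 * exp (- (1 / 8 * L ^ 3))"
    by (simp add: algebra_simps)
  ultimately show ?thesis
    using J unfolding A_def by linarith
qed

text \<open>The bound comes from the event that \<open>x + V s\<close> lies in a window of width of order \<open>1 / L\<^sup>2\<close>
  just below \<open>L\<close> and \<open>x + V t\<close> returns to \<open>{a..b}\<close>; both are only Gaussian-unlikely in \<open>L\<close>.\<close>

lemma expectation_peak_ge:
  assumes s: "t / 4 \<le> s" "s \<le> t / 2" "0 < t" and y: "y = exp (- (L ^ 3))"
    and L: "1 \<le> L" "1 / (3 * L\<^sup>2) \<le> (b - a) / 2"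
    and \<psi>: "\<And>u. 0 \<le> \<psi> u" "\<And>u. \<psi> u \<le> (1::real)" "\<And>u. a \<le> u \<Longrightarrow> u \<le> b \<Longrightarrow> c0 \<le> \<psi> u" "0 < c0"
    and [measurable]: "\<psi> \<in> borel_measurable borel"
  shows "c0 * (1 - cos (exp (-1))) * (b - a) / (12 * pi * t) / L\<^sup>2 *
            exp (- (4 * (L + (\<bar>x\<bar> + \<bar>a\<bar> + \<bar>b\<bar> + 1))\<^sup>2 / t))
       \<le> expectation (\<lambda>\<omega>. (1 - cos (y * exp ((x + V s \<omega>) ^ 3))) * \<psi> (x + V t \<omega>))"
proof -
  have st: "0 < s" "s < t" using s by auto
  \<comment> \<open>This width makes 3 L^2 \<delta> equal to 1, so the cube drops by at most 1
    across the window and the phase stays in [exp (-1), 1].\<close>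
  define \<delta> where "\<delta> = 1 / (3 * L\<^sup>2)"
  have \<delta>: "0 < \<delta>" "\<delta> \<le> (b - a) / 2" "\<delta> \<le> 1"
  proof -
    have "1 \<le> L\<^sup>2" using L by (simp add: one_le_power)
    then show "\<delta> \<le> 1" "0 < \<delta>" by (auto simp: \<delta>_def divide_le_eq)
    show "\<delta> \<le> (b - a) / 2" using L by (simp add: \<delta>_def)
  qed
  define K where "K = L + (\<bar>x\<bar> + \<bar>a\<bar> + \<bar>b\<bar> + 1)"
  define \<kappa> where "\<kappa> = 1 - cos (exp (-1::real))"
  have \<kappa>: "0 < \<kappa>" unfolding \<kappa>_def by (rule cos_gap_pos)
  define m where "m = exp (- (2 * K\<^sup>2 / t)) / sqrt (2 * pi * t)"
  have m: "0 \<le> m" using s by (simp add: m_def)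
  \<comment> \<open>\<open>I1\<close> puts x + V s into [L - \<delta>, L]. \<open>I2\<close> aims at
    the upper half of [a, b], leaving (b - a)/2 of slack below to absorb the uncertainty
    \<delta>.\<close>
  define I1 where "I1 = {L - \<delta> - x..L - x}"
  define I2 where "I2 = {(a + b) / 2 - L..b - L}"
  interpret N1: prob_space "gauss s" using st by (intro prob_space_normal_density) auto
  interpret N2: prob_space "gauss (t - s)" using st by (intro prob_space_normal_density) auto
  interpret N: pair_prob_space "gauss s" "gauss (t - s)" ..
  have m1: "\<delta> * m \<le> measure (gauss s) I1"
  proof -
    have "\<bar>L - \<delta> - x\<bar> \<le> K" "\<bar>L - x\<bar> \<le> K"
      unfolding K_def using L(1) \<delta> by linarith+
    then show ?thesis
      using measure_gauss_Icc_ge[of t s "L - \<delta> - x" "L - x" K] s \<delta> by (simp add: I1_def m_def)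
  qed
  have m2: "(b - a) / 2 * m \<le> measure (gauss (t - s)) I2"
  proof -
    have "\<bar>(a + b) / 2 - L\<bar> \<le> K" "\<bar>b - L\<bar> \<le> K" "(a + b) / 2 - L \<le> b - L"
      "b - L - ((a + b) / 2 - L) = (b - a) / 2"
      unfolding K_def using L(1) \<delta> by (linarith | simp add: field_simps)+
    moreover have "t / 4 \<le> t - s" "t - s \<le> t"
      using s by linarith+
    ultimately show ?thesis
      unfolding I2_def m_def using measure_gauss_Icc_ge[of t "t - s" "(a + b) / 2 - L" "b - L" K] s(3)
      by metis
  qed
  have ind: "c0 * \<kappa> * indicator (I1 \<times> I2) (V s \<omega>, V t \<omega> - V s \<omega>) \<le>
      (1 - cos (y * exp ((x + V s \<omega>) ^ 3))) * \<psi> (x + V t \<omega>)" for \<omega>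
  proof (cases "V s \<omega> \<in> I1 \<and> V t \<omega> - V s \<omega> \<in> I2")
    case True
    define v where "v = x + V s \<omega>"
    have v: "L - \<delta> \<le> v" "v \<le> L" using True by (auto simp: v_def I1_def)
    have "a \<le> x + V t \<omega>" "x + V t \<omega> \<le> b"
      using True v \<delta> by (auto simp: v_def I2_def field_simps)
    then have 1: "c0 \<le> \<psi> (x + V t \<omega>)" by (rule \<psi>(3))
    have "0 \<le> \<delta>\<^sup>2 * (3 * L - \<delta>)"
      using \<delta> L by (intro mult_nonneg_nonneg) auto
    moreover have "3 * L\<^sup>2 * \<delta> = 1"
      using L by (simp add: \<delta>_def)
    moreover have "(L - \<delta>) ^ 3 = L ^ 3 - 3 * L\<^sup>2 * \<delta> + \<delta>\<^sup>2 * (3 * L - \<delta>)"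
      by (simp add: power3_eq_cube power2_eq_square algebra_simps)
    moreover have "(L - \<delta>) ^ 3 \<le> v ^ 3" "v ^ 3 \<le> L ^ 3"
      using v by (auto intro: power_mono_odd)
    ultimately have "-1 \<le> v ^ 3 - L ^ 3" "v ^ 3 - L ^ 3 \<le> 0"
      by linarith+
    moreover have "y * exp (v ^ 3) = exp (v ^ 3 - L ^ 3)"
      by (simp add: y exp_add[symmetric])
    ultimately have "\<kappa> \<le> 1 - cos (y * exp (v ^ 3))"
      unfolding \<kappa>_def by (intro cos_gap) auto
    then have "\<kappa> * c0 \<le> (1 - cos (y * exp (v ^ 3))) * \<psi> (x + V t \<omega>)"
      using 1 \<psi>(4) \<kappa> by (intro mult_mono) auto
    then show ?thesis
      using True by (simp add: v_def mult.commute)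
  next
    case False
    then show ?thesis
      using \<psi>(1) by (auto simp: indicator_def)
  qed
  have pr: "prob ((\<lambda>\<omega>. (V s \<omega>, V t \<omega> - V s \<omega>)) -` (I1 \<times> I2) \<inter> space M) =
      measure (gauss s) I1 * measure (gauss (t - s)) I2"
  proof -
    have [simp]: "I1 \<in> sets borel" "I2 \<in> sets borel" by (auto simp: I1_def I2_def)
    have "prob ((\<lambda>\<omega>. (V s \<omega>, V t \<omega> - V s \<omega>)) -` (I1 \<times> I2) \<inter> space M) =
        measure (distr M (borel \<Otimes>\<^sub>M borel) (\<lambda>\<omega>. (V s \<omega>, V t \<omega> - V s \<omega>))) (I1 \<times> I2)"
    proof (rule measure_distr[symmetric])
      show "I1 \<times> I2 \<in> sets (borel \<Otimes>\<^sub>M borel)"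
        by (rule pair_measureI) simp_all
    qed measurable
    also have "\<dots> = measure (gauss s \<Otimes>\<^sub>M gauss (t - s)) (I1 \<times> I2)"
      by (simp add: law st)
    also have "\<dots> = measure (gauss s) I1 * measure (gauss (t - s)) I2"
      by (simp add: measure_def N2.emeasure_pair_measure_Times enn2real_mult)
    finally show ?thesis .
  qed
  \<comment> \<open>The factors 1/(3 L^2), (b - a)/2 and 1/(2 pi t) give the prefactor, and the two
    density bounds with exponent 2 K^2/t each give 4 K^2/t.\<close>
  have "c0 * \<kappa> * (b - a) / (12 * pi * t) / L\<^sup>2 * exp (- (4 * K\<^sup>2 / t)) =
      c0 * \<kappa> * ((\<delta> * m) * ((b - a) / 2 * m))"
  proof -
    have "m * m = exp (- (4 * K\<^sup>2 / t)) / (2 * pi * t)"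
      using s by (simp add: m_def exp_add[symmetric])
    then have "(\<delta> * m) * ((b - a) / 2 * m) = \<delta> * ((b - a) / 2) * (exp (- (4 * K\<^sup>2 / t)) / (2 * pi * t))"
      by (metis mult.assoc mult.left_commute)
    then show ?thesis
      by (simp add: \<delta>_def mult_ac)
  qed
  also have "\<dots> \<le> c0 * \<kappa> * (measure (gauss s) I1 * measure (gauss (t - s)) I2)"
    using m1 m2 m \<delta> \<kappa> \<psi>(4) by (intro mult_left_mono mult_mono) auto
  also have "\<dots> = expectation (\<lambda>\<omega>. c0 * \<kappa> * indicator (I1 \<times> I2) (V s \<omega>, V t \<omega> - V s \<omega>))"
  proof -
    have "expectation (\<lambda>\<omega>. indicator (I1 \<times> I2) (V s \<omega>, V t \<omega> - V s \<omega>)) =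
        expectation (indicator ((\<lambda>\<omega>. (V s \<omega>, V t \<omega> - V s \<omega>)) -` (I1 \<times> I2) \<inter> space M) :: 'w \<Rightarrow> real)"
      by (intro Bochner_Integration.integral_cong) (auto simp: indicator_def)
    also have "\<dots> = measure (gauss s) I1 * measure (gauss (t - s)) I2"
      by (simp add: pr)
    finally show ?thesis by simp
  qed
  also have "\<dots> \<le> expectation (\<lambda>\<omega>. (1 - cos (y * exp ((x + V s \<omega>) ^ 3))) * \<psi> (x + V t \<omega>))"
  proof (rule integral_mono)
    have [measurable]: "I1 \<times> I2 \<in> sets (borel \<Otimes>\<^sub>M borel)"
      by (auto simp: I1_def I2_def)
    show "integrable M (\<lambda>\<omega>. c0 * \<kappa> * indicator (I1 \<times> I2) (V s \<omega>, V t \<omega> - V s \<omega>))"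
    proof (rule integrable_const_bound[where B = "c0 * \<kappa>"])
      show "AE \<omega> in M. norm (c0 * \<kappa> * indicator (I1 \<times> I2) (V s \<omega>, V t \<omega> - V s \<omega>)) \<le> c0 * \<kappa>"
        using \<psi>(4) \<kappa> by (auto simp: indicator_def)
    qed measurable
    show "integrable M (\<lambda>\<omega>. (1 - cos (y * exp ((x + V s \<omega>) ^ 3))) * \<psi> (x + V t \<omega>))"
    proof (rule integrable_const_bound[where B = 2])
      have "\<bar>(1 - cos \<theta>) * \<psi> u\<bar> \<le> 2" for \<theta> u
        using mult_mono[of "1 - cos \<theta>" 2 "\<psi> u" 1] \<psi>(1,2)[of u] cos_le_one[of \<theta>] cos_ge_minus_one[of \<theta>]
        by (simp add: abs_mult)
      then show "AE \<omega> in M. norm ((1 - cos (y * exp ((x + V s \<omega>) ^ 3))) * \<psi> (x + V t \<omega>)) \<le> 2"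
        by simp
    qed measurable
  qed (rule ind)
  finally show ?thesis
    by (simp add: K_def \<kappa>_def)
qed

end

section \<open>Second differences of the weighted mean\<close>

text \<open>Scaled by 2^n to length above 2, the interval contains two consecutive integers; the odd
  one is admissible at every level.\<close>

lemma dyadic_between:
  assumes "a < (b::real)"
  obtains n m where "m \<in> Zset n" "a < of_int m / 2 ^ n" "of_int m / 2 ^ n < b"
proof -
  obtain n where n: "2 / (b - a) < 2 ^ n"
    using real_arch_pow[of 2 "2 / (b - a)"] by auto
  define k where "k = \<lfloor>a * 2 ^ n\<rfloor> + 1"
  have "a * 2 ^ n < of_int k" "of_int k \<le> a * 2 ^ n + 1"
    unfolding k_def by linarith+
  moreover have "2 < (b - a) * 2 ^ n"
    using n assms by (simp add: divide_less_eq mult.commute)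
  ultimately have k: "a * 2 ^ n < of_int k" "of_int k + 1 < b * 2 ^ n"
    by (simp_all add: left_diff_distrib)
  define m where "m = (if odd k then k else k + 1)"
  have m: "odd m" "a * 2 ^ n < of_int m" "of_int m < b * 2 ^ n"
    using k by (auto simp: m_def)
  have "of_int m / 2 \<notin> (\<int> :: real set)"
  proof
    assume "of_int m / 2 \<in> (\<int> :: real set)"
    then obtain j where "of_int m / 2 = (of_int j :: real)" by (auto elim: Ints_cases)
    then have "of_int m = (of_int (2 * j) :: real)" by simp
    then have "m = 2 * j" by (rule of_int_eq_iff[THEN iffD1])
    then show False using m(1) by simp
  qed
  then have "m \<in> Zset n" by (simp add: Zset_def)
  then show thesis
    using that[of m n] m by (simp add: field_simps)
qed

text \<open>The decomposition into nonincreasing functions lets the second mean value theorem apply to each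
  part.\<close>

definition cutoff :: "(real \<Rightarrow> real) \<Rightarrow> bool" where
  "cutoff \<psi> \<longleftrightarrow> continuous_on UNIV \<psi> \<and> (\<forall>u. 0 \<le> \<psi> u \<and> \<psi> u \<le> 1) \<and>
     (\<exists>a b c. a < b \<and> 0 < c \<and> (\<forall>u\<in>{a..b}. c \<le> \<psi> u)) \<and>
     (\<exists>\<eta>1 \<eta>2. antimono \<eta>1 \<and> antimono \<eta>2 \<and> (\<forall>u. 0 \<le> \<eta>1 u \<and> \<eta>1 u \<le> 1 \<and> 0 \<le> \<eta>2 u \<and> \<eta>2 u \<le> 1) \<and>
        (\<forall>u. \<psi> u = \<eta>1 u - \<eta>2 u))"

lemma cutoffD:
  assumes "cutoff \<psi>"
  shows "continuous_on UNIV \<psi>" "\<psi> \<in> borel_measurable borel" "0 \<le> \<psi> u" "\<psi> u \<le> 1" "\<bar>\<psi> u\<bar> \<le> 1"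
proof -
  show "continuous_on UNIV \<psi>" "0 \<le> \<psi> u" "\<psi> u \<le> 1"
    using assms unfolding cutoff_def by metis+
  then show "\<psi> \<in> borel_measurable borel" "\<bar>\<psi> u\<bar> \<le> 1"
    by (auto intro: borel_measurable_continuous_onI)
qed

text \<open>The interval is open so that every s in the space satisfies 0 < s < t, as the two-time
  law demands.\<close>

abbreviation interval_measure :: "real \<Rightarrow> real measure" where
  "interval_measure t \<equiv> restrict_space lborel {0<..<t}"

context gaussian_increments
begin

section \<open>Expectations integrated over time, and their peak and off-peak contributions\<close>

definition time_product :: "real \<Rightarrow> (real \<times> 'w) measure" where
  "time_product t = interval_measure t \<Otimes>\<^sub>M M"

lemma finite_interval_measure: "finite_measure (interval_measure t)"
proof (rule finite_measureI)
  have "emeasure lborel {0<..<t} \<noteq> \<infinity>"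
    by (cases "0 \<le> t") simp_all
  then show "emeasure (interval_measure t) (space (interval_measure t)) \<noteq> \<infinity>"
    by (simp add: emeasure_restrict_space space_restrict_space)
qed

lemma finite_time_product: "finite_measure (time_product t)"
  unfolding time_product_def by (rule finite_measure_pair_measure[OF finite_measure finite_interval_measure])

lemma pair_time: "pair_sigma_finite (interval_measure t) M"
  using finite_measure.axioms(1)[OF finite_interval_measure] sigma_finite_measure_axioms
  by (rule pair_sigma_finite.intro)

lemma measurable_fst_time [measurable]: "fst \<in> borel_measurable (time_product t)"
proof -
  have "(\<lambda>s. s) \<in> borel_measurable (interval_measure t)"
    by (rule measurable_restrict_space1) simp
  then show ?thesis
    unfolding time_product_def using measurable_compose[OF measurable_fst] by blast
qed

lemma measurable_snd_time [measurable]: "snd \<in> time_product t \<rightarrow>\<^sub>M M"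
  unfolding time_product_def by (rule measurable_snd)

lemma integral_time_product:
  assumes [measurable]: "f \<in> borel_measurable (time_product t)" and "\<And>p. \<bar>f p\<bar> \<le> (C::real)"
  shows "integral\<^sup>L (time_product t) f = (\<integral>s. expectation (\<lambda>\<omega>. f (s, \<omega>)) \<partial>interval_measure t)"
    "integrable (interval_measure t) (\<lambda>s. expectation (\<lambda>\<omega>. f (s, \<omega>)))"
    "integrable (time_product t) f"
proof -
  interpret pair_sigma_finite "interval_measure t" M by (rule pair_time)
  show i: "integrable (time_product t) f"
    by (rule finite_measure.integrable_const_bound[OF finite_time_product, of _ C]) (use assms in auto)
  show "integral\<^sup>L (time_product t) f = (\<integral>s. expectation (\<lambda>\<omega>. f (s, \<omega>)) \<partial>interval_measure t)"
    using integral_fst'[of f] i unfolding time_product_def by simp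
  show "integrable (interval_measure t) (\<lambda>s. expectation (\<lambda>\<omega>. f (s, \<omega>)))"
    using integrable_fst'[of f] i unfolding time_product_def by simp
qed

text \<open>This is E[X_1(t) \<psi>(X_2(t))] for the start (x1, x2, x3), with the solution
  eliminated. The weight 1 yields the first coordinate of the mean, and a bump yields the
  expectation of the test function.\<close>

definition weighted_mean :: "(real \<Rightarrow> real) \<Rightarrow> real \<Rightarrow> real \<Rightarrow> real \<Rightarrow> real \<Rightarrow> real" where
  "weighted_mean \<psi> t x1 x2 x3 = x1 * expectation (\<lambda>\<omega>. \<psi> (x2 + V t \<omega>)) +
     (\<integral>p. drift1 (x2 + V (fst p) (snd p)) x3 * \<psi> (x2 + V t (snd p)) \<partial>time_product t)"

lemma drift1_mult_bound: "\<bar>u\<bar> \<le> 1 \<Longrightarrow> \<bar>drift1 v z * u\<bar> \<le> drift_bound"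
  unfolding abs_mult using mult_mono[OF abs_drift1_le[of v z], of "\<bar>u\<bar>" 1] drift_bound_nonneg by simp

text \<open>Both measures are finite, so dominated convergence works with the constant majorants 1
  and \<open>drift_bound\<close>.\<close>

lemma continuous_weighted_mean:
  fixes t :: real
  assumes \<psi>: "cutoff \<psi>"
  shows "continuous_on UNIV (\<lambda>x :: real ^ 3. weighted_mean \<psi> t (x $ 1) (x $ 2) (x $ 3))"
proof (rule continuous_on_sequentiallyI)
  note [measurable] = cutoffD(2)[OF \<psi>]
  fix u :: "nat \<Rightarrow> real ^ 3" and x
  assume "u \<longlonglongrightarrow> x"
  then have u: "(\<lambda>n. u n $ i) \<longlonglongrightarrow> x $ i" for i
    by (rule tendsto_vec_nth)
  have cont: "isCont \<psi> v" for v
    using cutoffD(1)[OF \<psi>] by (simp add: continuous_on_eq_continuous_at)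
  have contd: "(\<lambda>n. drift1 (f n) (g n)) \<longlonglongrightarrow> drift1 v z"
    if "f \<longlonglongrightarrow> v" "g \<longlonglongrightarrow> z" for f g v z
  proof -
    have "isCont (\<lambda>(v, z). drift1 v z) (v, z)"
      using continuous_drift1 by (simp add: continuous_on_eq_continuous_at)
    from isCont_tendsto_compose[OF this tendsto_Pair[OF that]] show ?thesis by simp
  qed
  have "(\<lambda>n. expectation (\<lambda>\<omega>. \<psi> (u n $ 2 + V t \<omega>))) \<longlonglongrightarrow> expectation (\<lambda>\<omega>. \<psi> (x $ 2 + V t \<omega>))"
  proof (rule integral_dominated_convergence[where w = "\<lambda>_. 1"])
    show "AE \<omega> in M. (\<lambda>n. \<psi> (u n $ 2 + V t \<omega>)) \<longlonglongrightarrow> \<psi> (x $ 2 + V t \<omega>)"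
      by (intro AE_I2 isCont_tendsto_compose[OF cont] tendsto_add u tendsto_const)
    show "AE \<omega> in M. norm (\<psi> (u n $ 2 + V t \<omega>)) \<le> 1" for n
      using cutoffD(5)[OF \<psi>] by simp
    show "(\<lambda>\<omega>. \<psi> (x $ 2 + V t \<omega>)) \<in> borel_measurable M"
      by measurable
    show "(\<lambda>\<omega>. \<psi> (u n $ 2 + V t \<omega>)) \<in> borel_measurable M" for n
      by measurable
  qed simp
  moreover have "(\<lambda>n. \<integral>p. drift1 (u n $ 2 + V (fst p) (snd p)) (u n $ 3) * \<psi> (u n $ 2 + V t (snd p)) \<partial>time_product t)
      \<longlonglongrightarrow> (\<integral>p. drift1 (x $ 2 + V (fst p) (snd p)) (x $ 3) * \<psi> (x $ 2 + V t (snd p)) \<partial>time_product t)"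
  proof (rule integral_dominated_convergence[where w = "\<lambda>_. drift_bound"])
    show "integrable (time_product t) (\<lambda>_. drift_bound)"
      by (rule finite_measure.integrable_const[OF finite_time_product])
    show "AE p in time_product t.
        (\<lambda>n. drift1 (u n $ 2 + V (fst p) (snd p)) (u n $ 3) * \<psi> (u n $ 2 + V t (snd p)))
          \<longlonglongrightarrow> drift1 (x $ 2 + V (fst p) (snd p)) (x $ 3) * \<psi> (x $ 2 + V t (snd p))"
      by (intro AE_I2 tendsto_mult contd isCont_tendsto_compose[OF cont] tendsto_add u tendsto_const)
    show "AE p in time_product t.
        norm (drift1 (u n $ 2 + V (fst p) (snd p)) (u n $ 3) * \<psi> (u n $ 2 + V t (snd p))) \<le> drift_bound" for n
      using drift1_mult_bound cutoffD(5)[OF \<psi>] by auto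
    show "(\<lambda>p. drift1 (x $ 2 + V (fst p) (snd p)) (x $ 3) * \<psi> (x $ 2 + V t (snd p)))
        \<in> borel_measurable (time_product t)"
      by measurable
    show "(\<lambda>p. drift1 (u n $ 2 + V (fst p) (snd p)) (u n $ 3) * \<psi> (u n $ 2 + V t (snd p)))
        \<in> borel_measurable (time_product t)" for n
      by measurable
  qed
  ultimately show "(\<lambda>n. weighted_mean \<psi> t (u n $ 1) (u n $ 2) (u n $ 3))
      \<longlonglongrightarrow> weighted_mean \<psi> t (x $ 1) (x $ 2) (x $ 3)"
    unfolding weighted_mean_def by (intro tendsto_add tendsto_mult u)
qed

text \<open>Up to the factor \<open>2 * dweight\<close>, this is the weighted contribution to the
  second difference with step \<open>y\<close> of a drift term centred at distance \<open>d\<close>;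
  the peak is d = 0.\<close>

definition spectral :: "(real \<Rightarrow> real) \<Rightarrow> real \<Rightarrow> real \<Rightarrow> real \<Rightarrow> real \<Rightarrow> real \<times> 'w \<Rightarrow> real" where
  "spectral \<psi> t x y d = (\<lambda>p. cos (d * exp ((x + V (fst p) (snd p)) ^ 3)) *
     (1 - cos (y * exp ((x + V (fst p) (snd p)) ^ 3))) * \<psi> (x + V t (snd p)))"

lemma abs_spectral_le: "\<bar>\<psi> (x + V t (snd p))\<bar> \<le> 1 \<Longrightarrow> \<bar>spectral \<psi> t x y d p\<bar> \<le> 2"
proof -
  have "\<bar>c * (1 - cos \<theta>) * u\<bar> \<le> 1 * 2 * 1" if "\<bar>c\<bar> \<le> 1" "\<bar>u\<bar> \<le> 1" for c \<theta> u :: real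
    unfolding abs_mult using that cos_ge_minus_one[of \<theta>] cos_le_one[of \<theta>]
    by (intro mult_mono) auto
  then show "\<bar>\<psi> (x + V t (snd p))\<bar> \<le> 1 \<Longrightarrow> ?thesis"
    by (simp add: spectral_def)
qed

lemma measurable_spectral [measurable]:
  assumes [measurable]: "\<psi> \<in> borel_measurable borel"
  shows "spectral \<psi> t x y d \<in> borel_measurable (time_product t)"
  unfolding spectral_def by measurable

text \<open>The bound at a fixed time is uniform in s, so integration over (0, t) costs only the
  factor t.\<close>

lemma spectral_off_peak_antimono:
  assumes t: "0 < t" and d: "d \<noteq> 0" and y: "y = exp (- (L ^ 3))" "y \<le> \<bar>d\<bar> / 2"
    and L: "2 \<le> L" "2 * (x + 1) \<le> L"
    and \<eta>: "antimono \<eta>" "\<And>u. 0 \<le> \<eta> u" "\<And>u. \<eta> u \<le> (1::real)"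
  shows "\<bar>integral\<^sup>L (time_product t) (spectral \<eta> t x y d)\<bar> \<le>
    t * ((12 / \<bar>d\<bar> + 1 / 2) * exp (- (1 / 8 * L ^ 3)))"
proof -
  note [measurable] = antimono_borel_measurable[OF \<eta>(1)]
  have \<eta>a: "\<bar>\<eta> u\<bar> \<le> 1" for u
    using \<eta>(2,3)[of u] by simp
  have b: "\<bar>spectral \<eta> t x y d p\<bar> \<le> 2" for p
    by (rule abs_spectral_le[of \<eta>, OF \<eta>a])
  let ?c = "(12 / \<bar>d\<bar> + 1 / 2) * exp (- (1 / 8 * L ^ 3))"
  interpret T: finite_measure "interval_measure t" by (rule finite_interval_measure)
  have "\<bar>integral\<^sup>L (time_product t) (spectral \<eta> t x y d)\<bar> =
      \<bar>\<integral>s. expectation (\<lambda>\<omega>. spectral \<eta> t x y d (s, \<omega>)) \<partial>interval_measure t\<bar>"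
    by (subst integral_time_product(1)[OF measurable_spectral b]) measurable
  also have "\<dots> \<le> (\<integral>s. \<bar>expectation (\<lambda>\<omega>. spectral \<eta> t x y d (s, \<omega>))\<bar> \<partial>interval_measure t)"
    by (rule integral_abs_bound)
  also have "\<dots> \<le> (\<integral>s. ?c \<partial>interval_measure t)"
  proof (rule integral_mono)
    show "integrable (interval_measure t) (\<lambda>s. \<bar>expectation (\<lambda>\<omega>. spectral \<eta> t x y d (s, \<omega>))\<bar>)"
      by (intro integrable_abs integral_time_product(2)[OF measurable_spectral b]) measurable
    fix s assume "s \<in> space (interval_measure t)"
    then have s: "0 < s" "s < t" by (auto simp: space_restrict_space)
    show "\<bar>expectation (\<lambda>\<omega>. spectral \<eta> t x y d (s, \<omega>))\<bar> \<le> ?c"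
      unfolding spectral_def using expectation_off_peak_le[OF s d y L \<eta>] by simp
  qed simp
  also have "\<dots> = t * ?c"
    using t by (simp add: space_restrict_space measure_restrict_space)
  finally show ?thesis .
qed

lemma spectral_off_peak:
  assumes t: "0 < t" and d: "d \<noteq> 0" and y: "y = exp (- (L ^ 3))" "y \<le> \<bar>d\<bar> / 2"
    and L: "2 \<le> L" "2 * (x + 1) \<le> L" and \<psi>: "cutoff \<psi>"
  shows "\<bar>integral\<^sup>L (time_product t) (spectral \<psi> t x y d)\<bar> \<le>
    2 * t * (12 / \<bar>d\<bar> + 1 / 2) * exp (- (1 / 8 * L ^ 3))"
proof -
  obtain \<eta>1 \<eta>2 where \<eta>: "antimono \<eta>1" "\<And>u. 0 \<le> \<eta>1 u" "\<And>u. \<eta>1 u \<le> (1::real)"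
    "antimono \<eta>2" "\<And>u. 0 \<le> \<eta>2 u" "\<And>u. \<eta>2 u \<le> (1::real)" "\<And>u. \<psi> u = \<eta>1 u - \<eta>2 u"
    using \<psi> unfolding cutoff_def by metis
  note [measurable] = antimono_borel_measurable[OF \<eta>(1)] antimono_borel_measurable[OF \<eta>(4)]
  have \<eta>a: "\<bar>\<eta>1 u\<bar> \<le> 1" "\<bar>\<eta>2 u\<bar> \<le> 1" for u
    using \<eta>(2,3,5,6)[of u] by simp_all
  have b: "\<bar>spectral \<eta>1 t x y d p\<bar> \<le> 2" "\<bar>spectral \<eta>2 t x y d p\<bar> \<le> 2" for p
    by (rule abs_spectral_le[of \<eta>1, OF \<eta>a(1)], rule abs_spectral_le[of \<eta>2, OF \<eta>a(2)])
  have "spectral \<psi> t x y d p = spectral \<eta>1 t x y d p - spectral \<eta>2 t x y d p" for p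
    by (simp add: spectral_def \<eta>(7) right_diff_distrib)
  then have "integral\<^sup>L (time_product t) (spectral \<psi> t x y d) =
      (\<integral>p. spectral \<eta>1 t x y d p - spectral \<eta>2 t x y d p \<partial>time_product t)"
    by (intro Bochner_Integration.integral_cong refl)
  also have "\<dots> = integral\<^sup>L (time_product t) (spectral \<eta>1 t x y d) -
      integral\<^sup>L (time_product t) (spectral \<eta>2 t x y d)"
    by (intro Bochner_Integration.integral_diff integral_time_product(3)[OF measurable_spectral b(1)]
        integral_time_product(3)[OF measurable_spectral b(2)]) measurable
  finally show ?thesis
    using spectral_off_peak_antimono[OF t d y L \<eta>(1,2,3)] spectral_off_peak_antimono[OF t d y L \<eta>(4,5,6)]
    by (simp add: mult.assoc)
qed

text \<open>For d = 0 the integrand is nonnegative, so the time integral may be cut down to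
  [t/4, t/2], where both variances s and t - s are comparable to t. The length of that interval
  contributes the factor t/4.\<close>

lemma spectral_peak:
  assumes t: "0 < t" and \<psi>: "cutoff \<psi>"
  obtains c K where "0 < c" "\<forall>\<^sub>F L in at_top. c / L\<^sup>2 * exp (- (4 * (L + K)\<^sup>2 / t)) \<le>
    integral\<^sup>L (time_product t) (spectral \<psi> t x (exp (- (L ^ 3))) 0)"
proof -
  note [measurable] = cutoffD(2)[OF \<psi>]
  obtain a b c0 where c0: "a < b" "0 < c0" "\<And>u. a \<le> u \<Longrightarrow> u \<le> b \<Longrightarrow> c0 \<le> \<psi> u"
    using \<psi> unfolding cutoff_def by auto
  define c where "c = c0 * (1 - cos (exp (-1))) * (b - a) / (12 * pi * t)"
  define K where "K = \<bar>x\<bar> + \<bar>a\<bar> + \<bar>b\<bar> + 1"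
  have c: "0 < c"
    unfolding c_def using c0 t cos_gap_pos by (intro divide_pos_pos mult_pos_pos) auto
  have ev: "\<forall>\<^sub>F L in at_top. 1 / (3 * L\<^sup>2) \<le> (b - a) / 2"
  proof -
    have "((\<lambda>L. 1 / (3 * L\<^sup>2) :: real) \<longlongrightarrow> 0) at_top" by real_asymp
    then have "\<forall>\<^sub>F L in at_top. 1 / (3 * L\<^sup>2) < (b - a) / 2"
      by (rule order_tendstoD) (use c0 in simp)
    then show ?thesis by eventually_elim simp
  qed
  have "\<forall>\<^sub>F L in at_top. (t / 4 * c) / L\<^sup>2 * exp (- (4 * (L + K)\<^sup>2 / t)) \<le>
    integral\<^sup>L (time_product t) (spectral \<psi> t x (exp (- (L ^ 3))) 0)"
    using ev eventually_ge_at_top[of 1]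
  proof eventually_elim
    case (elim L)
    define y where "y = exp (- (L ^ 3))"
    let ?B = "c / L\<^sup>2 * exp (- (4 * (L + K)\<^sup>2 / t))"
    have b: "\<bar>spectral \<psi> t x y 0 p\<bar> \<le> 2" for p
      by (rule abs_spectral_le[of \<psi>, OF cutoffD(5)[OF \<psi>]])
    interpret T: finite_measure "interval_measure t" by (rule finite_interval_measure)
    have "(t / 4 * c) / L\<^sup>2 * exp (- (4 * (L + K)\<^sup>2 / t)) = t / 4 * ?B" by simp
    also have "\<dots> = (\<integral>s. ?B * indicator {t/4..t/2} s \<partial>interval_measure t)"
    proof -
      have "measure (interval_measure t) {t/4..t/2} = t / 4"
        using t by (subst measure_restrict_space) auto
      moreover have "{t/4..t/2} \<inter> space (interval_measure t) = {t/4..t/2}"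
        using t by (auto simp: space_restrict_space)
      ultimately have "(\<integral>s. indicator {t/4..t/2} s \<partial>interval_measure t) = t / 4"
        by simp
      then show ?thesis
        by (simp only: integral_mult_right_zero) (simp only: mult.commute)
    qed
    also have "\<dots> \<le> (\<integral>s. expectation (\<lambda>\<omega>. spectral \<psi> t x y 0 (s, \<omega>)) \<partial>interval_measure t)"
    proof (rule integral_mono)
      have "{t/4..t/2} \<in> sets (interval_measure t)"
        using t by (subst sets_restrict_space_iff) auto
      then show "integrable (interval_measure t) (\<lambda>s. ?B * indicator {t/4..t/2} s)"
        by (intro integrable_mult_right) (simp add: T.emeasure_finite less_top[symmetric])
      show "integrable (interval_measure t) (\<lambda>s. expectation (\<lambda>\<omega>. spectral \<psi> t x y 0 (s, \<omega>)))"
        by (rule integral_time_product(2)[OF _ b]) measurable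
      fix s assume "s \<in> space (interval_measure t)"
      show "?B * indicator {t/4..t/2} s \<le> expectation (\<lambda>\<omega>. spectral \<psi> t x y 0 (s, \<omega>))"
      proof (cases "s \<in> {t/4..t/2}")
        case True
        then show ?thesis
          using expectation_peak_ge[of t s y L b a \<psi> c0 x] t elim c0 cutoffD[OF \<psi>]
          by (simp add: spectral_def y_def c_def K_def)
      next
        case False
        have "0 \<le> expectation (\<lambda>\<omega>. spectral \<psi> t x y 0 (s, \<omega>))"
          unfolding spectral_def
          by (intro Bochner_Integration.integral_nonneg) (simp add: cutoffD[OF \<psi>])
        then show ?thesis using False by simp
      qed
    qed
    also have "\<dots> = integral\<^sup>L (time_product t) (spectral \<psi> t x y 0)"
      by (rule integral_time_product(1)[OF _ b, symmetric]) measurable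
    finally show ?case by (simp add: y_def)
  qed
  then show thesis
    using that[of "t / 4 * c" K] c t by simp
qed

text \<open>All choices go through one parameter L with y = exp (-(L^3)). Each requirement on y then
  becomes an eventual statement as L grows, and finitely many of those hold together.\<close>

lemma weighted_mean_second_difference_not_small:
  assumes t: "0 < t" and \<psi>: "cutoff \<psi>" and z: "m0 \<in> Zset n0" "z = of_int m0 / 2 ^ n0"
    and \<alpha>: "0 < \<alpha>" and r: "0 < r"
  shows "\<exists>y. 0 < y \<and> y < r \<and> C * y powr \<alpha> <
    2 * weighted_mean \<psi> t x1 x2 z - weighted_mean \<psi> t x1 x2 (z + y) - weighted_mean \<psi> t x1 x2 (z - y)"
proof -
  note [measurable] = cutoffD(2)[OF \<psi>]
  obtain F d w0 where F: "finite F" "0 < w0" "\<And>p. p \<in> F \<Longrightarrow> d p \<noteq> (0::real)"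
    "\<And>v y. (1 - cos (y * exp (v ^ 3))) *
              (w0 + 2 * (\<Sum>p\<in>F. dweight p * cos (d p * exp (v ^ 3))))
            \<le> 2 * drift1 v z - drift1 v (z + y) - drift1 v (z - y)"
    using drift1_second_difference[OF z] by blast
  obtain c K where cK: "0 < c" "\<forall>\<^sub>F L in at_top. c / L\<^sup>2 * exp (- (4 * (L + K)\<^sup>2 / t)) \<le>
    integral\<^sup>L (time_product t) (spectral \<psi> t x2 (exp (- (L ^ 3))) 0)"
    by (rule spectral_peak[OF t \<psi>])
  \<comment> \<open>With \<beta> below both \<alpha> and 1/8, a single exponential exp (-\<beta>
    L^3) majorizes y^\<alpha> as well as the off-peak errors.\<close>
  define \<beta> where "\<beta> = min \<alpha> (1 / 8)"
  have \<beta>: "0 < \<beta>" "\<beta> \<le> \<alpha>" "\<beta> \<le> 1 / 8" using \<alpha> by (auto simp: \<beta>_def)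
  define S where "S = (\<Sum>p\<in>F. dweight p * (2 * t * (12 / \<bar>d p\<bar> + 1 / 2)))"
  have S: "0 \<le> S"
    unfolding S_def using t dweight_pos by (intro sum_nonneg mult_nonneg_nonneg add_nonneg_nonneg) (auto simp: less_imp_le)
  have ylim: "((\<lambda>L::real. exp (- (L ^ 3))) \<longlongrightarrow> 0) at_top" by real_asymp
  have "\<forall>\<^sub>F L in at_top. exp (- (L ^ 3)) < r"
    using ylim r by (rule order_tendstoD)
  moreover have "\<forall>\<^sub>F L in at_top. \<forall>p\<in>F. exp (- (L ^ 3)) < \<bar>d p\<bar> / 2"
    using F(1,3) by (intro eventually_ball_finite ballI order_tendstoD(2)[OF ylim]) auto
  moreover have "\<forall>\<^sub>F L in at_top. (\<bar>C\<bar> + 2 * S) * exp (- (\<beta> * L ^ 3)) < (w0 * c) / L\<^sup>2 * exp (- (4 * (L + K)\<^sup>2 / t))"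
    using F(2) cK(1) t \<beta>(1) by (intro lower_dominates) auto
  moreover note cK(2) eventually_ge_at_top[of 2] eventually_ge_at_top[of "2 * (x2 + 1)"]
  ultimately have "\<forall>\<^sub>F L in at_top. exp (- (L ^ 3)) < r \<and> (\<forall>p\<in>F. exp (- (L ^ 3)) < \<bar>d p\<bar> / 2) \<and>
      (\<bar>C\<bar> + 2 * S) * exp (- (\<beta> * L ^ 3)) < (w0 * c) / L\<^sup>2 * exp (- (4 * (L + K)\<^sup>2 / t)) \<and>
      c / L\<^sup>2 * exp (- (4 * (L + K)\<^sup>2 / t)) \<le>
        integral\<^sup>L (time_product t) (spectral \<psi> t x2 (exp (- (L ^ 3))) 0) \<and> 2 \<le> L \<and> 2 * (x2 + 1) \<le> L"
    by eventually_elim blast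
  from eventually_happens'[OF trivial_limit_at_top_linorder this]
  obtain L where L: "exp (- (L ^ 3)) < r" "\<And>p. p \<in> F \<Longrightarrow> exp (- (L ^ 3)) < \<bar>d p\<bar> / 2"
      "(\<bar>C\<bar> + 2 * S) * exp (- (\<beta> * L ^ 3)) < (w0 * c) / L\<^sup>2 * exp (- (4 * (L + K)\<^sup>2 / t))"
      "c / L\<^sup>2 * exp (- (4 * (L + K)\<^sup>2 / t)) \<le>
        integral\<^sup>L (time_product t) (spectral \<psi> t x2 (exp (- (L ^ 3))) 0)" "2 \<le> L" "2 * (x2 + 1) \<le> L"
    by blast
  define y where "y = exp (- (L ^ 3))"
  define Q where "Q e = integral\<^sup>L (time_product t) (spectral \<psi> t x2 y e)" for e
  define X where "X u = (\<integral>p. drift1 (x2 + V (fst p) (snd p)) u * \<psi> (x2 + V t (snd p)) \<partial>time_product t)" for u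
  have Xi: "integrable (time_product t) (\<lambda>p. drift1 (x2 + V (fst p) (snd p)) u * \<psi> (x2 + V t (snd p)))" for u
    by (rule integral_time_product(3)[OF _ drift1_mult_bound[OF cutoffD(5)[OF \<psi>]]]) measurable
  have Qi: "integrable (time_product t) (spectral \<psi> t x2 y e)" for e
    by (rule integral_time_product(3)[OF measurable_spectral abs_spectral_le[OF cutoffD(5)[OF \<psi>]]]) measurable
  have L3: "0 \<le> L ^ 3" using L(5) by simp
  have exp_le: "exp (- (\<gamma> * L ^ 3)) \<le> exp (- (\<beta> * L ^ 3))" if "\<beta> \<le> \<gamma>" for \<gamma>
    using mult_right_mono[OF that L3] by simp
  have up: "\<bar>\<Sum>p\<in>F. dweight p * Q (d p)\<bar> \<le> S * exp (- (\<beta> * L ^ 3))"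
  proof -
    have "\<bar>\<Sum>p\<in>F. dweight p * Q (d p)\<bar> \<le> (\<Sum>p\<in>F. \<bar>dweight p * Q (d p)\<bar>)"
      by (rule sum_abs)
    also have "\<dots> \<le> (\<Sum>p\<in>F. dweight p * (2 * t * (12 / \<bar>d p\<bar> + 1 / 2)) * exp (- (1 / 8 * L ^ 3)))"
    proof (rule sum_mono)
      fix p assume p: "p \<in> F"
      have "\<bar>Q (d p)\<bar> \<le> 2 * t * (12 / \<bar>d p\<bar> + 1 / 2) * exp (- (1 / 8 * L ^ 3))"
        unfolding Q_def using F(3)[OF p] L(2)[OF p] L(5,6) t \<psi>
        by (intro spectral_off_peak) (auto simp: y_def)
      from mult_left_mono[OF this, of "dweight p"]
      show "\<bar>dweight p * Q (d p)\<bar> \<le> dweight p * (2 * t * (12 / \<bar>d p\<bar> + 1 / 2)) * exp (- (1 / 8 * L ^ 3))"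
        using dweight_pos[of p] by (simp add: abs_mult mult.assoc)
    qed
    also have "\<dots> = S * exp (- (1 / 8 * L ^ 3))"
      by (simp add: S_def sum_distrib_right)
    also have "\<dots> \<le> S * exp (- (\<beta> * L ^ 3))"
      by (intro mult_left_mono exp_le \<beta> S)
    finally show ?thesis .
  qed
  have "w0 * Q 0 + 2 * (\<Sum>p\<in>F. dweight p * Q (d p)) =
      (\<integral>p. w0 * spectral \<psi> t x2 y 0 p + 2 * (\<Sum>q\<in>F. dweight q * spectral \<psi> t x2 y (d q) p) \<partial>time_product t)"
    unfolding Q_def using Qi by simp
  also have "\<dots> \<le> (\<integral>p. 2 * (drift1 (x2 + V (fst p) (snd p)) z * \<psi> (x2 + V t (snd p))) -
      drift1 (x2 + V (fst p) (snd p)) (z + y) * \<psi> (x2 + V t (snd p)) -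
      drift1 (x2 + V (fst p) (snd p)) (z - y) * \<psi> (x2 + V t (snd p)) \<partial>time_product t)"
  proof (rule integral_mono)
    fix p
    define v u where "v = x2 + V (fst p) (snd p)" and "u = \<psi> (x2 + V t (snd p))"
    have "w0 * spectral \<psi> t x2 y 0 p + 2 * (\<Sum>q\<in>F. dweight q * spectral \<psi> t x2 y (d q) p) =
        (1 - cos (y * exp (v ^ 3))) * (w0 + 2 * (\<Sum>q\<in>F. dweight q * cos (d q * exp (v ^ 3)))) * u"
      unfolding spectral_def v_def[symmetric] u_def[symmetric]
      by (simp add: distrib_left distrib_right sum_distrib_left sum_distrib_right mult_ac)
    \<comment> \<open>Here the weight is used whole: its nonnegativity preserves the pointwise
      inequality, which would fail to combine for a difference of monotone parts. The monotone parts
      serve only the off-peak bounds.\<close>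
    also have "\<dots> \<le> (2 * drift1 v z - drift1 v (z + y) - drift1 v (z - y)) * u"
      by (intro mult_right_mono F(4)) (simp add: u_def cutoffD[OF \<psi>])
    finally show "w0 * spectral \<psi> t x2 y 0 p + 2 * (\<Sum>q\<in>F. dweight q * spectral \<psi> t x2 y (d q) p) \<le>
      2 * (drift1 (x2 + V (fst p) (snd p)) z * \<psi> (x2 + V t (snd p))) -
      drift1 (x2 + V (fst p) (snd p)) (z + y) * \<psi> (x2 + V t (snd p)) -
      drift1 (x2 + V (fst p) (snd p)) (z - y) * \<psi> (x2 + V t (snd p))"
      unfolding v_def u_def by (simp add: left_diff_distrib)
  qed (use Xi Qi in auto)
  also have "\<dots> = 2 * X z - X (z + y) - X (z - y)"
    unfolding X_def using Xi by simp
  \<comment> \<open>The summand containing \<open>x1\<close> does not depend on the third coordinate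
    and cancels in the second difference.\<close>
  also have "\<dots> = 2 * weighted_mean \<psi> t x1 x2 z - weighted_mean \<psi> t x1 x2 (z + y) -
      weighted_mean \<psi> t x1 x2 (z - y)"
    by (simp add: weighted_mean_def X_def)
  finally have main: "w0 * Q 0 + 2 * (\<Sum>p\<in>F. dweight p * Q (d p)) \<le>
      2 * weighted_mean \<psi> t x1 x2 z - weighted_mean \<psi> t x1 x2 (z + y) - weighted_mean \<psi> t x1 x2 (z - y)" .
  have "(w0 * c) / L\<^sup>2 * exp (- (4 * (L + K)\<^sup>2 / t)) \<le> w0 * Q 0"
    using mult_left_mono[OF L(4), of w0] F(2) by (simp add: Q_def y_def mult.assoc)
  moreover have "C * y powr \<alpha> \<le> \<bar>C\<bar> * exp (- (\<beta> * L ^ 3))"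
  proof -
    have "y powr \<alpha> = exp (- (\<alpha> * L ^ 3))"
      by (simp add: y_def powr_def)
    then show ?thesis
      using mult_mono[OF abs_ge_self exp_le[OF \<beta>(2)], of C] by simp
  qed
  moreover have "(\<bar>C\<bar> + 2 * S) * exp (- (\<beta> * L ^ 3)) =
      \<bar>C\<bar> * exp (- (\<beta> * L ^ 3)) + 2 * (S * exp (- (\<beta> * L ^ 3)))"
    by (simp add: distrib_right)
  ultimately have "C * y powr \<alpha> < w0 * Q 0 + 2 * (\<Sum>p\<in>F. dweight p * Q (d p))"
    using L(3) up by linarith
  then show ?thesis
    using main L(1) by (intro exI[of _ y]) (auto simp: y_def)
qed

text \<open>Locally, a Hoelder bound controls the second difference as a sum of two first
  differences, hence by 2 C y^\<alpha>. Moving along the third axis reaches a dyadic third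
  coordinate inside any nonempty open set, and the contradiction arises there.\<close>

lemma weighted_mean_not_locally_holder:
  assumes t: "0 < t" and \<psi>: "cutoff \<psi>" and U: "open U" "U \<noteq> ({} :: (real ^ 3) set)"
  shows "\<not> locally_holder_continuous_on U (\<lambda>x. weighted_mean \<psi> t (x $ 1) (x $ 2) (x $ 3))"
proof
  define h where "h x = weighted_mean \<psi> t (x $ 1) (x $ 2) (x $ 3)" for x :: "real ^ 3"
  assume "locally_holder_continuous_on U (\<lambda>x. weighted_mean \<psi> t (x $ 1) (x $ 2) (x $ 3))"
  then have hol: "locally_holder_continuous_on U h" by (simp add: h_def[abs_def])
  obtain x0 where "x0 \<in> U" using U by auto
  then obtain \<epsilon> where \<epsilon>: "0 < \<epsilon>" "ball x0 \<epsilon> \<subseteq> U"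
    using U(1) open_contains_ball by blast
  obtain n m where nm: "m \<in> Zset n" "x0 $ 3 < of_int m / 2 ^ n" "of_int m / 2 ^ n < x0 $ 3 + \<epsilon>"
    using dyadic_between[of "x0 $ 3" "x0 $ 3 + \<epsilon>"] \<epsilon>(1) by (metis less_add_same_cancel1)
  define z where "z = (of_int m / 2 ^ n :: real)"
  \<comment> \<open>The line through \<open>x0\<close> parallel to the third axis, parametrized
    isometrically by the third coordinate.\<close>
  define P where "P u = (x0 + (u - x0 $ 3) *\<^sub>R axis 3 1 :: real ^ 3)" for u
  have P: "P u $ 1 = x0 $ 1" "P u $ 2 = x0 $ 2" "P u $ 3 = u" for u
    by (simp_all add: P_def axis_def)
  have distP: "dist (P u) (P v) = \<bar>u - v\<bar>" for u v
    by (simp add: P_def dist_norm scaleR_diff_left[symmetric])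
  have "P (x0 $ 3) = x0" by (simp add: P_def)
  then have "dist x0 (P z) < \<epsilon>"
    using distP[of "x0 $ 3" z] nm by (simp add: z_def)
  then have "P z \<in> U" using \<epsilon> by auto
  then have "\<exists>V. open V \<and> P z \<in> V \<and> (\<exists>\<alpha>. 0 < \<alpha> \<and> \<alpha> \<le> 1 \<and> holder_continuous_on \<alpha> (U \<inter> V) h)"
    using hol by (simp add: locally_holder_continuous_on_def)
  then obtain W \<alpha> where W: "open W" "P z \<in> W" "0 < \<alpha>" "holder_continuous_on \<alpha> (U \<inter> W) h"
    by blast
  then obtain C where C:
    "\<And>x y. x \<in> U \<inter> W \<Longrightarrow> y \<in> U \<inter> W \<Longrightarrow> dist (h x) (h y) \<le> C * dist x y powr \<alpha>"
    unfolding holder_continuous_on_def by blast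
  have "open (U \<inter> W)" "P z \<in> U \<inter> W" using U W \<open>P z \<in> U\<close> by auto
  then obtain r where r: "0 < r" "ball (P z) r \<subseteq> U \<inter> W"
    using open_contains_ball by blast
  obtain y where y: "0 < y" "y < r" "2 * C * y powr \<alpha> <
    2 * weighted_mean \<psi> t (x0 $ 1) (x0 $ 2) z - weighted_mean \<psi> t (x0 $ 1) (x0 $ 2) (z + y) -
      weighted_mean \<psi> t (x0 $ 1) (x0 $ 2) (z - y)"
    using weighted_mean_second_difference_not_small[OF t \<psi> nm(1) z_def W(3) r(1), of "2 * C" "x0 $ 1" "x0 $ 2"]
    by blast
  have in_ball: "P z \<in> U \<inter> W" "P (z + y) \<in> U \<inter> W" "P (z - y) \<in> U \<inter> W"
    using r y distP by (auto intro!: subsetD[OF r(2)])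
  have "\<bar>h (P z) - h (P (z + y))\<bar> \<le> C * y powr \<alpha>" "\<bar>h (P z) - h (P (z - y))\<bar> \<le> C * y powr \<alpha>"
    using C[OF in_ball(1,2)] C[OF in_ball(1,3)] distP[of z "z + y"] distP[of z "z - y"] y(1)
    by (simp_all add: dist_real_def)
  then show False
    using y(3) unfolding h_def P by linarith
qed

end

section \<open>A smooth test function\<close>

text \<open>All derivatives of a function of one variable are named at once, so that an induction
  can pass from \<open>D j\<close> to \<open>D (Suc j)\<close> without iterating a derivative
  operator.\<close>

definition deriv_seq :: "(nat \<Rightarrow> real \<Rightarrow> real) \<Rightarrow> bool" where
  "deriv_seq D \<longleftrightarrow> (\<forall>k x. (D k has_real_derivative D (Suc k) x) (at x))"

section \<open>Closure properties of k-fold continuous differentiability\<close>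

lemma times_cont_diff_imp_continuous:
  "times_cont_diff k f \<Longrightarrow> continuous_on UNIV f"
  by (cases k) (auto intro: continuous_at_imp_continuous_on differentiable_imp_continuous_within)

text \<open>The product and chain rules leave factors undifferentiated; the inductions below need
  these at one order lower.\<close>

lemma times_cont_diff_Suc_imp: "times_cont_diff (Suc k) f \<Longrightarrow> times_cont_diff k f"
proof (induction k arbitrary: f)
  case 0
  then show ?case using times_cont_diff_imp_continuous[OF 0] by simp
next
  case (Suc k)
  then show ?case by (metis times_cont_diff.simps(2))
qed

lemma times_cont_diff_const: "times_cont_diff k (\<lambda>x::'a::euclidean_space. c :: real)"
proof (induction k arbitrary: c)
  case (Suc k)
  then show ?case by (auto simp: frechet_derivative_const)
qed simp

lemma times_cont_diff_add:
  fixes f g :: "'a::euclidean_space \<Rightarrow> real"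
  assumes "times_cont_diff k f" "times_cont_diff k g"
  shows "times_cont_diff k (\<lambda>x. f x + g x)"
  using assms
proof (induction k arbitrary: f g)
  case 0
  then show ?case by (auto intro: continuous_intros)
next
  case (Suc k)
  then have d: "f differentiable (at x)" "g differentiable (at x)" for x by auto
  have "frechet_derivative (\<lambda>x. f x + g x) (at x) v =
      frechet_derivative f (at x) v + frechet_derivative g (at x) v" for x v
    by (rule fun_cong[OF frechet_derivative_at[symmetric]])
       (rule has_derivative_add; simp add: d frechet_derivative_works[symmetric])
  then show ?case
    using Suc d by (auto intro: differentiable_add)
qed

lemma times_cont_diff_mult:
  fixes f g :: "'a::euclidean_space \<Rightarrow> real"
  assumes "times_cont_diff k f" "times_cont_diff k g"
  shows "times_cont_diff k (\<lambda>x. f x * g x)"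
  using assms
proof (induction k arbitrary: f g)
  case 0
  then show ?case by (auto intro: continuous_intros)
next
  case (Suc k)
  then have d: "f differentiable (at x)" "g differentiable (at x)" for x by auto
  have "frechet_derivative (\<lambda>x. f x * g x) (at x) v =
      f x * frechet_derivative g (at x) v + frechet_derivative f (at x) v * g x" for x v
    by (rule fun_cong[OF frechet_derivative_at[symmetric]])
       (rule has_derivative_mult; simp add: d frechet_derivative_works[symmetric])
  then show ?case
    using Suc d times_cont_diff_Suc_imp[OF Suc.prems(1)] times_cont_diff_Suc_imp[OF Suc.prems(2)]
    by (auto intro!: differentiable_mult times_cont_diff_add)
qed

text \<open>The chain rule produces D (Suc j) (f x) times a directional derivative of f. The
  induction therefore runs with \<open>j\<close> arbitrary and ends in the product rule.\<close>

lemma times_cont_diff_compose: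
  fixes f :: "'a::euclidean_space \<Rightarrow> real"
  assumes "deriv_seq D" "times_cont_diff k f"
  shows "times_cont_diff k (\<lambda>x. D j (f x))"
  using assms(2)
proof (induction k arbitrary: j)
  case 0
  have "continuous_on UNIV (D j)"
    using assms(1) DERIV_isCont unfolding deriv_seq_def continuous_on_eq_continuous_at[OF open_UNIV] by blast
  with 0 show ?case by (auto intro: continuous_on_compose2)
next
  case (Suc k)
  then have d: "f differentiable (at x)" for x by auto
  have D: "((\<lambda>x. D j (f x)) has_derivative (\<lambda>v. D (Suc j) (f x) * frechet_derivative f (at x) v)) (at x)" for x
  proof -
    have "(D j has_derivative (*) (D (Suc j) (f x))) (at (f x))"
      using assms(1) by (simp add: deriv_seq_def has_field_derivative_def)
    from has_derivative_compose[OF d[unfolded frechet_derivative_works] this] show ?thesis by simp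
  qed
  have "frechet_derivative (\<lambda>x. D j (f x)) (at x) v = D (Suc j) (f x) * frechet_derivative f (at x) v" for x v
    by (rule fun_cong[OF frechet_derivative_at[OF D, symmetric]])
  moreover have "times_cont_diff k (\<lambda>x. D (Suc j) (f x) * frechet_derivative f (at x) v)" for v
    using Suc.prems by (intro times_cont_diff_mult Suc.IH times_cont_diff_Suc_imp[OF Suc.prems]) auto
  moreover have "(\<lambda>x. D j (f x)) differentiable (at x)" for x
    using D differentiableI by blast
  ultimately show ?case by simp
qed

lemma times_cont_diff_linear:
  fixes f :: "'a::euclidean_space \<Rightarrow> real"
  assumes "bounded_linear f"
  shows "times_cont_diff k f"
proof (cases k)
  case 0
  then show ?thesis using assms by (simp add: linear_continuous_on)
next
  case (Suc j)
  have d: "(f has_derivative f) (at x)" for x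
    using assms by (rule bounded_linear_imp_has_derivative)
  have "frechet_derivative f (at x) v = f v" for x v
    by (rule fun_cong[OF frechet_derivative_at[OF d, symmetric]])
  then show ?thesis
    using Suc d times_cont_diff_const by (auto intro: differentiableI)
qed

text \<open>The recursion is the derivative rule for p (1/u) exp (-1/u), whose derivative is (1/u)^2
  (p (1/u) - p' (1/u)) exp (-1/u).\<close>

fun flat_poly :: "nat \<Rightarrow> real poly" where
  "flat_poly 0 = 1"
| "flat_poly (Suc k) = [:0, 0, 1:] * (flat_poly k - pderiv (flat_poly k))"

text \<open>The classical flat function exp (-1/u), extended by 0, together with all its
  derivatives.\<close>

definition flat :: "nat \<Rightarrow> real \<Rightarrow> real" where
  "flat k u = (if 0 < u then poly (flat_poly k) (1 / u) * exp (- (1 / u)) else 0)"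

lemma tendsto_poly_exp_at_zero:
  "((\<lambda>u. poly p (1 / u) * exp (- (1 / u)) :: real) \<longlongrightarrow> 0) (at_right 0)"
proof -
  have "((\<lambda>u. \<Sum>i\<le>degree p. coeff p i * ((1 / u) ^ i * exp (- (1 / u))) :: real) \<longlongrightarrow>
      (\<Sum>i\<le>degree p. coeff p i * 0)) (at_right 0)"
  proof (intro tendsto_sum tendsto_mult tendsto_const)
    show "((\<lambda>u. (1 / u) ^ i * exp (- (1 / u)) :: real) \<longlongrightarrow> 0) (at_right 0)" for i
      by real_asymp
  qed
  then show ?thesis
    by (simp add: poly_altdef sum_distrib_right mult.assoc)
qed

lemma deriv_seq_flat: "deriv_seq flat"
  unfolding deriv_seq_def
proof (intro allI)
  fix k and x :: real
  consider "0 < x" | "x < 0" | "x = 0" by linarith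
  then show "(flat k has_real_derivative flat (Suc k) x) (at x)"
  proof cases
    case 1
    have "((\<lambda>u. poly (flat_poly k) (1 / u) * exp (- (1 / u))) has_real_derivative flat (Suc k) x) (at x)"
      using 1 by (auto intro!: derivative_eq_intros DERIV_chain2[OF poly_DERIV]
          simp: flat_def field_simps power2_eq_square)
    then show ?thesis
      by (rule DERIV_cong_ev[THEN iffD1, rotated -1])
        (use eventually_nhds_in_open[of "{0<..}" x] 1 in \<open>auto elim!: eventually_mono simp: flat_def\<close>)
  next
    case 2
    have "((\<lambda>u::real. 0::real) has_real_derivative 0) (at x)" by simp
    then have "(flat k has_real_derivative 0) (at x)"
      by (rule DERIV_cong_ev[THEN iffD1, rotated -1])
        (use eventually_nhds_in_open[of "{..<0}" x] 2 in \<open>auto elim!: eventually_mono simp: flat_def\<close>)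
    then show ?thesis using 2 by (simp add: flat_def)
  next
    case 3
    have "((\<lambda>h. flat k h / h) \<longlongrightarrow> 0) (at_left 0)"
      by (rule tendsto_eventually) (auto simp: flat_def eventually_at_left_field intro!: exI[of _ "-1"])
    moreover have "((\<lambda>h. flat k h / h) \<longlongrightarrow> 0) (at_right 0)"
    proof (rule Lim_transform_eventually)
      \<comment> \<open>The difference quotient at 0 divides by u, which only multiplies the
        polynomial in 1/u by its variable.\<close>
      show "((\<lambda>u. poly ([:0, 1:] * flat_poly k) (1 / u) * exp (- (1 / u))) \<longlongrightarrow> 0) (at_right 0)"
        by (rule tendsto_poly_exp_at_zero)
      show "\<forall>\<^sub>F u in at_right 0. poly ([:0, 1:] * flat_poly k) (1 / u) * exp (- (1 / u)) = flat k u / u"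
        using eventually_at_right_less[of 0] by eventually_elim (simp add: flat_def)
    qed
    ultimately have "((\<lambda>h. flat k h / h) \<longlongrightarrow> 0) (at 0)"
      by (rule filterlim_split_at)
    then show ?thesis
      using 3 by (simp add: DERIV_def flat_def)
  qed
qed

text \<open>Composing the flat function with itself avoids the quotient in the usual construction of a
  smooth step.\<close>

definition step :: "real \<Rightarrow> real" where
  "step u = exp 1 * flat 0 (1 - exp 1 * flat 0 u)"

lemma flat_0: "flat 0 u = (if 0 < u then exp (- (1 / u)) else 0)"
  by (simp add: flat_def)

lemma flat_0_mono:
  assumes "u \<le> v"
  shows "flat 0 u \<le> flat 0 v"
proof (cases "0 < u")
  case True
  then have "1 / v \<le> 1 / u"
    using assms by (intro divide_left_mono) auto
  then show ?thesis
    using True assms by (simp add: flat_0)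
next
  case False
  then show ?thesis by (simp add: flat_0)
qed

text \<open>The factor exp 1 normalizes the flat function to the value 1 at 1; it keeps both layers
  of \<open>step\<close> within range.\<close>

lemma flat_0_le: "u \<le> 1 \<Longrightarrow> exp 1 * flat 0 u \<le> 1"
proof -
  assume "u \<le> 1"
  then have "exp 1 * flat 0 u \<le> exp 1 * flat 0 1"
    by (intro mult_left_mono flat_0_mono) simp_all
  also have "\<dots> = 1"
    by (simp add: flat_0 exp_add[symmetric])
  finally show ?thesis .
qed

lemma antimono_step: "antimono step"
proof (rule antimonoI)
  fix u v :: real
  assume "u \<le> v"
  then have "exp 1 * flat 0 u \<le> exp 1 * flat 0 v"
    by (intro mult_left_mono flat_0_mono) simp_all
  then show "step v \<le> step u"
    unfolding step_def by (intro mult_left_mono flat_0_mono) simp_all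
qed

lemma step_bounds: "0 \<le> step u" "step u \<le> 1"
proof -
  show "0 \<le> step u" by (simp add: step_def flat_0)
  show "step u \<le> 1" unfolding step_def by (rule flat_0_le) (simp add: flat_0)
qed

lemma step_left: "u \<le> 0 \<Longrightarrow> step u = 1"
  by (simp add: step_def flat_0 exp_add[symmetric])

lemma step_right:
  assumes "1 \<le> u"
  shows "step u = 0"
proof -
  have "exp 1 * flat 0 1 \<le> exp 1 * flat 0 u"
    using assms by (intro mult_left_mono flat_0_mono) simp_all
  then have "1 \<le> exp 1 * flat 0 u"
    by (simp add: flat_0 exp_add[symmetric])
  then show ?thesis
    by (simp add: step_def flat_0[of "1 - exp 1 * flat 0 u"])
qed

lemma times_cont_diff_step:
  fixes f :: "'a::euclidean_space \<Rightarrow> real"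
  assumes "times_cont_diff k f"
  shows "times_cont_diff k (\<lambda>x. step (f x))"
proof -
  have "times_cont_diff k (\<lambda>x. 1 + - exp 1 * flat 0 (f x))"
    by (intro times_cont_diff_add times_cont_diff_mult times_cont_diff_const
        times_cont_diff_compose[OF deriv_seq_flat] assms)
  then have "times_cont_diff k (\<lambda>x. exp 1 * flat 0 (1 + - exp 1 * flat 0 (f x)))"
    by (intro times_cont_diff_mult times_cont_diff_const times_cont_diff_compose[OF deriv_seq_flat])
  then show ?thesis by (simp add: step_def)
qed

lemma continuous_step: "continuous_on UNIV step"
  by (rule times_cont_diff_imp_continuous[OF times_cont_diff_step[OF times_cont_diff_linear[OF bounded_linear_ident]]])

section \<open>Plateaus, the bump and the test function\<close>

definition plateau :: "real \<Rightarrow> real \<Rightarrow> real" where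
  "plateau K u = step (u - K) * step (- u - K)"

lemma plateau_inside: "\<bar>u\<bar> \<le> K \<Longrightarrow> plateau K u = 1"
  by (simp add: plateau_def step_left)

lemma plateau_outside: "K + 1 \<le> \<bar>u\<bar> \<Longrightarrow> plateau K u = 0"
  by (cases "0 \<le> u") (simp_all add: plateau_def step_right)

text \<open>In contrast to the product in \<open>plateau\<close>, a difference of shifted steps
  displays the two nonincreasing parts that \<open>cutoff\<close> demands.\<close>

definition bump :: "real \<Rightarrow> real" where
  "bump u = step u - step (u + 1)"

lemma bump_outside: "1 \<le> \<bar>u\<bar> \<Longrightarrow> bump u = 0"
  by (cases "0 \<le> u") (simp_all add: bump_def step_left step_right)

text \<open>The linear factor carries the time integral of the drift. Where both plateaus equal 1,
  the function reduces to x1 times the bump, so its expectation is a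
  \<open>weighted_mean\<close>.\<close>

definition test_function :: "real \<Rightarrow> real \<Rightarrow> real ^ 3 \<Rightarrow> real" where
  "test_function K c x = x $ 1 * plateau K (x $ 1) * bump (x $ 2) * plateau c (x $ 3)"

lemma infinitely_differentiable_test_function: "infinitely_differentiable (test_function K c)"
proof -
  have l: "times_cont_diff k (\<lambda>x :: real ^ 3. x $ i)" for k i
    by (intro times_cont_diff_linear bounded_linear_vec_nth)
  have p: "times_cont_diff k (\<lambda>x :: real ^ 3. plateau c (x $ i))" for k c i
  proof -
    have "times_cont_diff k (\<lambda>x :: real ^ 3. step (x $ i + - c) * step (-1 * x $ i + - c))"
      by (intro times_cont_diff_mult times_cont_diff_step times_cont_diff_add times_cont_diff_const l)
    then show ?thesis by (simp add: plateau_def)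
  qed
  have b: "times_cont_diff k (\<lambda>x :: real ^ 3. bump (x $ i))" for k i
  proof -
    have "times_cont_diff k (\<lambda>x :: real ^ 3. step (x $ i) + -1 * step (x $ i + 1))"
      by (intro times_cont_diff_mult times_cont_diff_step times_cont_diff_add times_cont_diff_const l)
    then show ?thesis by (simp add: bump_def)
  qed
  show ?thesis
    unfolding infinitely_differentiable_def test_function_def[abs_def]
    by (intro allI times_cont_diff_mult l p b)
qed

lemma has_compact_support_test_function: "has_compact_support (test_function K c)"
proof -
  define R where "R = max 1 (max (K + 1) (c + 1))"
  have "\<bar>x $ i\<bar> \<le> R" if "test_function K c x \<noteq> 0" for x i
  proof -
    have ne: "plateau K (x $ 1) \<noteq> 0" "bump (x $ 2) \<noteq> 0" "plateau c (x $ 3) \<noteq> 0"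
      using that by (simp_all add: test_function_def)
    then have "\<bar>x $ 1\<bar> \<le> K + 1" "\<bar>x $ 2\<bar> \<le> 1" "\<bar>x $ 3\<bar> \<le> c + 1"
      using plateau_outside[of K "x $ 1"] plateau_outside[of c "x $ 3"] bump_outside[of "x $ 2"]
      by linarith+
    then show ?thesis
      using exhaust_3[of i] by (auto simp: R_def)
  qed
  then have "{x. test_function K c x \<noteq> 0} \<subseteq> cbox (\<chi> i. - R) (\<chi> i. R)"
    unfolding mem_box_cart subset_iff mem_Collect_eq vec_lambda_beta by (metis abs_le_D1 abs_le_D2 minus_le_iff)
  then have "bounded {x. test_function K c x \<noteq> 0}"
    using bounded_cbox bounded_subset by blast
  then show ?thesis
    by (simp add: has_compact_support_def compact_closure)
qed

section \<open>Solutions of the stochastic differential equation\<close>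

text \<open>Rounding time down to the grid of mesh 1/(n + 1) leaves countably many times, hence a
  jointly measurable process; continuity of the paths gives pointwise convergence. Negative times
  are sent to 0, where the assumptions speak again.\<close>

lemma jointly_measurable_continuous_paths:
  fixes Y :: "real \<Rightarrow> 'w \<Rightarrow> real"
  assumes meas: "\<And>t. 0 \<le> t \<Longrightarrow> Y t \<in> borel_measurable M"
    and cont: "\<And>\<omega>. \<omega> \<in> space M \<Longrightarrow> continuous_on {0..} (\<lambda>t. Y t \<omega>)"
  shows "(\<lambda>(s, \<omega>). Y (max 0 s) \<omega>) \<in> borel_measurable (borel \<Otimes>\<^sub>M M)"
proof -
  define r where "r n s = max 0 (real_of_int \<lfloor>real (Suc n) * s\<rfloor> / real (Suc n))" for n s
  have "(\<lambda>p. Y (max 0 (fst p)) (snd p)) \<in> borel_measurable (borel \<Otimes>\<^sub>M M)"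
  proof (rule borel_measurable_LIMSEQ_metric)
    fix n
    have [measurable]: "(\<lambda>p. Y (max 0 (real_of_int k / real (Suc n))) (snd p)) \<in> borel_measurable (borel \<Otimes>\<^sub>M M)" for k
      by (rule measurable_compose[OF measurable_snd meas]) simp
    have "(\<lambda>p. Y (max 0 (real_of_int \<lfloor>real (Suc n) * fst p\<rfloor> / real (Suc n))) (snd p))
        \<in> borel_measurable (borel \<Otimes>\<^sub>M M)"
      by (rule measurable_compose_countable[where g = "\<lambda>p. \<lfloor>real (Suc n) * fst p\<rfloor>"]) measurable
    then show "(\<lambda>p. Y (r n (fst p)) (snd p)) \<in> borel_measurable (borel \<Otimes>\<^sub>M M)"
      by (simp add: r_def)
  next
    fix p :: "real \<times> 'w" assume "p \<in> space (borel \<Otimes>\<^sub>M M)"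
    then have p: "snd p \<in> space M" by (auto simp: space_pair_measure)
    have "(\<lambda>n. real_of_int \<lfloor>real (Suc n) * fst p\<rfloor> / real (Suc n)) \<longlonglongrightarrow> fst p"
    proof (rule tendsto_sandwich)
      show "(\<lambda>n. fst p - 1 / real (Suc n)) \<longlonglongrightarrow> fst p"
        by real_asymp
      show "(\<lambda>n. fst p) \<longlonglongrightarrow> fst p" by simp
      have "fst p - 1 / real (Suc n) \<le> real_of_int \<lfloor>real (Suc n) * fst p\<rfloor> / real (Suc n)" for n
      proof -
        have "real (Suc n) * fst p - 1 \<le> real_of_int \<lfloor>real (Suc n) * fst p\<rfloor>" by linarith
        then have "(real (Suc n) * fst p - 1) / real (Suc n) \<le> real_of_int \<lfloor>real (Suc n) * fst p\<rfloor> / real (Suc n)"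
          by (rule divide_right_mono) simp
        moreover have "(real (Suc n) * fst p - 1) / real (Suc n) = fst p - 1 / real (Suc n)"
          by (subst diff_divide_distrib) simp
        ultimately show ?thesis by simp
      qed
      then show "\<forall>\<^sub>F n in sequentially. fst p - 1 / real (Suc n) \<le> real_of_int \<lfloor>real (Suc n) * fst p\<rfloor> / real (Suc n)"
        by simp
      have "real_of_int \<lfloor>real (Suc n) * fst p\<rfloor> / real (Suc n) \<le> fst p" for n
      proof -
        have "real_of_int \<lfloor>real (Suc n) * fst p\<rfloor> \<le> fst p * real (Suc n)"
          by (subst mult.commute) (rule of_int_floor_le)
        then show ?thesis by (subst pos_divide_le_eq) simp_all
      qed
      then show "\<forall>\<^sub>F n in sequentially. real_of_int \<lfloor>real (Suc n) * fst p\<rfloor> / real (Suc n) \<le> fst p"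
        by simp
    qed
    then have "(\<lambda>n. r n (fst p)) \<longlonglongrightarrow> max 0 (fst p)"
      unfolding r_def by (intro tendsto_max tendsto_const)
    then show "(\<lambda>n. Y (r n (fst p)) (snd p)) \<longlonglongrightarrow> Y (max 0 (fst p)) (snd p)"
      by (rule continuous_on_tendsto_compose[OF cont[OF p]]) (simp_all add: r_def)
  qed
  then show ?thesis by (simp add: case_prod_unfold)
qed

text \<open>The case of two increments of the independence axiom, turned from an indexed family into
  a pair: independent variables have the product of their laws as joint law.\<close>

lemma (in prob_space) brownian_increment_law:
  assumes W: "standard_brownian_motion M W" and st: "0 < s" "s < t"
  shows "distr M (borel \<Otimes>\<^sub>M borel) (\<lambda>\<omega>. (W s \<omega> - W 0 \<omega>, W t \<omega> - W s \<omega>)) = gauss s \<Otimes>\<^sub>M gauss (t - s)"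
proof -
  \<comment> \<open>The grid is 0, s, t and then constant, so the increments with index 0 and 1 are
    the two required.\<close>
  define \<tau> where "\<tau> i = (if i = 0 then 0 else if i = Suc 0 then s else t)" for i :: nat
  define D where "D i \<omega> = W (\<tau> (Suc i)) \<omega> - W (\<tau> i) \<omega>" for i :: nat and \<omega>
  have "indep_vars (\<lambda>_. borel) D {..<2}"
  proof -
    have "\<forall>n \<tau>. 0 \<le> \<tau> 0 \<and> (\<forall>i<n. \<tau> i \<le> \<tau> (Suc i)) \<longrightarrow>
        indep_vars (\<lambda>_. borel) (\<lambda>i \<omega>. W (\<tau> (Suc i)) \<omega> - W (\<tau> i) \<omega>) {..<n}"
      using W unfolding standard_brownian_motion_def by (elim conjE)
    from this[rule_format, of \<tau> 2] show ?thesis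
      using st by (auto simp: \<tau>_def D_def[abs_def] less_2_cases_iff)
  qed
  then have "indep_var (PiM {0} (\<lambda>_. borel)) (\<lambda>\<omega>. restrict (\<lambda>i. D i \<omega>) {0})
      (PiM {1} (\<lambda>_. borel)) (\<lambda>\<omega>. restrict (\<lambda>i. D i \<omega>) {1})"
    by (rule indep_var_restrict) auto
  then have "indep_var borel ((\<lambda>f. f 0) \<circ> (\<lambda>\<omega>. restrict (\<lambda>i. D i \<omega>) {0}))
      borel ((\<lambda>f. f 1) \<circ> (\<lambda>\<omega>. restrict (\<lambda>i. D i \<omega>) {1}))"
    by (rule indep_var_compose) (auto intro: measurable_component_singleton)
  then have "indep_var borel (\<lambda>\<omega>. W s \<omega> - W 0 \<omega>) borel (\<lambda>\<omega>. W t \<omega> - W s \<omega>)"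
    by (simp add: o_def D_def \<tau>_def)
  then have *: "distr M borel (\<lambda>\<omega>. W s \<omega> - W 0 \<omega>) \<Otimes>\<^sub>M distr M borel (\<lambda>\<omega>. W t \<omega> - W s \<omega>) =
      distr M (borel \<Otimes>\<^sub>M borel) (\<lambda>\<omega>. (W s \<omega> - W 0 \<omega>, W t \<omega> - W s \<omega>))"
    by (simp add: indep_var_distribution_eq)
  have d: "distr M borel (\<lambda>\<omega>. W v \<omega> - W u \<omega>) = gauss (v - u)" if "0 \<le> u" "u < v" for u v
  proof -
    have "distributed M lborel (\<lambda>\<omega>. W v \<omega> - W u \<omega>) (normal_density 0 (sqrt (v - u)))"
      using W that unfolding standard_brownian_motion_def by blast
    from distributed_distr_eq_density[OF this]
    have "distr M lborel (\<lambda>\<omega>. W v \<omega> - W u \<omega>) = gauss (v - u)" .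
    moreover have "distr M borel (\<lambda>\<omega>. W v \<omega> - W u \<omega>) = distr M lborel (\<lambda>\<omega>. W v \<omega> - W u \<omega>)"
      by (rule distr_cong) simp_all
    ultimately show ?thesis by simp
  qed
  have "distr M borel (\<lambda>\<omega>. W s \<omega> - W 0 \<omega>) = gauss s"
    using d[of 0 s] st(1) by (simp only: diff_zero order_refl)
  moreover have "distr M borel (\<lambda>\<omega>. W t \<omega> - W s \<omega>) = gauss (t - s)"
    using st by (intro d) simp_all
  ultimately show ?thesis
    by (simp only: *[symmetric])
qed

lemma sde_solution_components:
  assumes "sde_solution M W drift diffusion x Y"
  shows "AE \<omega> in M. \<forall>t\<ge>0. Y t \<omega> $ 2 = x $ 2 + (W t \<omega> - W 0 \<omega>) \<and> Y t \<omega> $ 3 = x $ 3 \<and>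
    Y t \<omega> $ 1 = x $ 1 + (LINT s:{0..t}|lborel. drift1 (Y s \<omega> $ 2) (Y s \<omega> $ 3))"
proof -
  have "AE \<omega> in M. \<forall>t\<ge>0. set_integrable lborel {0..t} (\<lambda>s. drift (Y s \<omega>)) \<and>
        Y t \<omega> = x + (LINT s:{0..t}|lborel. drift (Y s \<omega>)) + (W t \<omega> - W 0 \<omega>) *\<^sub>R diffusion"
    using assms unfolding sde_solution_def by (elim conjE)
  then show ?thesis
  proof eventually_elim
    case (elim \<omega>)
    show ?case
    proof (intro allI impI)
      fix t :: real assume "0 \<le> t"
      with elim have i: "set_integrable lborel {0..t} (\<lambda>s. drift (Y s \<omega>))"
        and eq: "Y t \<omega> = x + (LINT s:{0..t}|lborel. drift (Y s \<omega>)) + (W t \<omega> - W 0 \<omega>) *\<^sub>R diffusion"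
        by blast+
      have comp: "(LINT s:{0..t}|lborel. drift (Y s \<omega>)) $ j = (LINT s:{0..t}|lborel. drift (Y s \<omega>) $ j)" for j
        using integral_bounded_linear[OF bounded_linear_vec_nth, of lborel "\<lambda>s. indicator {0..t} s *\<^sub>R drift (Y s \<omega>)" j] i
        by (simp add: set_integrable_def set_lebesgue_integral_def)
      show "Y t \<omega> $ 2 = x $ 2 + (W t \<omega> - W 0 \<omega>) \<and> Y t \<omega> $ 3 = x $ 3 \<and>
        Y t \<omega> $ 1 = x $ 1 + (LINT s:{0..t}|lborel. drift1 (Y s \<omega> $ 2) (Y s \<omega> $ 3))"
        unfolding eq vector_add_component comp drift_nth
        by (simp add: diffusion_def set_lebesgue_integral_def)
    qed
  qed
qed

lemma set_integral_Icc_eq_interval_measure: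
  fixes f :: "real \<Rightarrow> real"
  assumes "\<And>s. 0 < s \<Longrightarrow> s < t \<Longrightarrow> f s = g s" and [measurable]: "f \<in> borel_measurable borel" "g \<in> borel_measurable borel"
  shows "(LINT s:{0..t}|lborel. f s) = (\<integral>s. g s \<partial>interval_measure t)"
proof -
  have "(\<integral>s. g s \<partial>interval_measure t) = (\<integral>s. indicator {0<..<t} s *\<^sub>R g s \<partial>lborel)"
    by (rule integral_restrict_space) simp
  also have "\<dots> = (\<integral>s. indicator {0..t} s *\<^sub>R f s \<partial>lborel)"
  proof (rule integral_cong_AE)
    have "AE s in lborel. s \<noteq> 0 \<and> s \<noteq> t"
      using AE_lborel_singleton[of 0] AE_lborel_singleton[of t] by eventually_elim simp
    then show "AE s in lborel. indicator {0<..<t} s *\<^sub>R g s = indicator {0..t} s *\<^sub>R f s"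
      by eventually_elim (auto simp: indicator_def assms(1))
  qed measurable
  finally show ?thesis by (simp add: set_lebesgue_integral_def)
qed

text \<open>Fubini in the order opposite to that of the estimates: the solution formula integrates
  over time along a fixed path, the estimates take expectations at a fixed time.\<close>

lemma (in gaussian_increments) integral_time_product_snd:
  assumes [measurable]: "f \<in> borel_measurable (time_product t)" and "\<And>p. \<bar>f p\<bar> \<le> (C::real)"
  shows "integral\<^sup>L (time_product t) f = expectation (\<lambda>\<omega>. \<integral>s. f (s, \<omega>) \<partial>interval_measure t)"
    "integrable M (\<lambda>\<omega>. \<integral>s. f (s, \<omega>) \<partial>interval_measure t)"
proof -
  interpret pair_sigma_finite "interval_measure t" M by (rule pair_time)
  have i: "integrable (interval_measure t \<Otimes>\<^sub>M M) f"
    using integral_time_product(3)[OF assms] by (simp add: time_product_def)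
  show "integral\<^sup>L (time_product t) f = expectation (\<lambda>\<omega>. \<integral>s. f (s, \<omega>) \<partial>interval_measure t)"
    using integral_snd[of "\<lambda>s \<omega>. f (s, \<omega>)"] i unfolding time_product_def by (simp add: case_prod_unfold)
  show "integrable M (\<lambda>\<omega>. \<integral>s. f (s, \<omega>) \<partial>interval_measure t)"
    using integrable_snd[of "\<lambda>s \<omega>. f (s, \<omega>)"] i by (simp add: case_prod_unfold)
qed

lemma (in gaussian_increments) weighted_mean_eq_expectation:
  assumes \<psi>: "cutoff \<psi>"
  shows "weighted_mean \<psi> t x1 x2 x3 =
    expectation (\<lambda>\<omega>. (x1 + (\<integral>s. drift1 (x2 + V s \<omega>) x3 \<partial>interval_measure t)) * \<psi> (x2 + V t \<omega>))"
proof -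
  note [measurable] = cutoffD(2)[OF \<psi>]
  let ?f = "\<lambda>p. drift1 (x2 + V (fst p) (snd p)) x3 * \<psi> (x2 + V t (snd p))"
  have m: "?f \<in> borel_measurable (time_product t)" by measurable
  note b = drift1_mult_bound[OF cutoffD(5)[OF \<psi>]]
  have i: "integrable M (\<lambda>\<omega>. x1 * \<psi> (x2 + V t \<omega>))"
    by (intro integrable_mult_right integrable_const_bound[where B = 1]) (simp add: cutoffD(5)[OF \<psi>], measurable)
  have "weighted_mean \<psi> t x1 x2 x3 =
      expectation (\<lambda>\<omega>. x1 * \<psi> (x2 + V t \<omega>) + (\<integral>s. ?f (s, \<omega>) \<partial>interval_measure t))"
    unfolding weighted_mean_def integral_time_product_snd(1)[OF m b]
    using Bochner_Integration.integral_add[OF i integral_time_product_snd(2)[OF m b]] by simp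
  also have "\<dots> = expectation (\<lambda>\<omega>. (x1 + (\<integral>s. drift1 (x2 + V s \<omega>) x3 \<partial>interval_measure t)) * \<psi> (x2 + V t \<omega>))"
    by (intro Bochner_Integration.integral_cong refl) (simp add: distrib_right)
  finally show ?thesis .
qed

text \<open>It serves two purposes: passing from the vector-valued mean to its first coordinate, and
  replacing a function by one that agrees with it only on \<open>U\<close>.\<close>

lemma locally_holder_continuous_on_contract:
  assumes "locally_holder_continuous_on U f"
    and "\<And>x y. x \<in> U \<Longrightarrow> y \<in> U \<Longrightarrow> dist (g x) (g y) \<le> dist (f x) (f y)"
  shows "locally_holder_continuous_on U g"
  unfolding locally_holder_continuous_on_def
proof
  fix x assume "x \<in> U"
  then obtain V \<alpha> where V: "open V" "x \<in> V" "0 < \<alpha>" "\<alpha> \<le> 1" "holder_continuous_on \<alpha> (U \<inter> V) f"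
    using assms(1) unfolding locally_holder_continuous_on_def by blast
  then obtain C where C: "\<forall>x\<in>U \<inter> V. \<forall>y\<in>U \<inter> V. dist (f x) (f y) \<le> C * dist x y powr \<alpha>"
    unfolding holder_continuous_on_def by blast
  have "holder_continuous_on \<alpha> (U \<inter> V) g"
    unfolding holder_continuous_on_def using assms(2) C by (metis IntD1 order_trans)
  with V show "\<exists>V. open V \<and> x \<in> V \<and> (\<exists>\<alpha>>0. \<alpha> \<le> 1 \<and> holder_continuous_on \<alpha> (U \<inter> V) g)"
    by blast
qed

section \<open>The two admissible weights and the conclusion\<close>

lemma cutoff_one: "cutoff (\<lambda>_. 1)"
  unfolding cutoff_def
proof (intro conjI)
  show "\<exists>(a::real) b c. a < b \<and> 0 < c \<and> (\<forall>u\<in>{a..b}. c \<le> (1::real))"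
    by (rule exI[of _ 0], rule exI[of _ 1], rule exI[of _ 1]) simp
  show "\<exists>\<eta>1 \<eta>2. antimono \<eta>1 \<and> antimono \<eta>2 \<and> (\<forall>u::real. 0 \<le> \<eta>1 u \<and> \<eta>1 u \<le> 1 \<and> 0 \<le> \<eta>2 u \<and> \<eta>2 u \<le> 1) \<and>
        (\<forall>u. (1::real) = \<eta>1 u - \<eta>2 u)"
    by (rule exI[of _ "\<lambda>_. 1"], rule exI[of _ "\<lambda>_. 0"]) (simp add: monotone_on_def)
qed auto

lemma cutoff_bump: "cutoff bump"
  unfolding cutoff_def
proof (intro conjI allI)
  show "continuous_on UNIV bump"
    unfolding bump_def[abs_def]
    by (intro continuous_on_diff continuous_step continuous_on_compose2[OF continuous_step] continuous_on_add
        continuous_on_id continuous_on_const) simp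
  show "0 \<le> bump u" for u
    using antimonoD[OF antimono_step, of u "u + 1"] by (simp add: bump_def)
  show "bump u \<le> 1" for u
    using step_bounds(2)[of u] step_bounds(1)[of "u + 1"] by (simp add: bump_def)
  have pos: "0 < step (1 / 2)"
    by (simp add: step_def flat_0 exp_add[symmetric])
  \<comment> \<open>On [0, 1/2] the shifted step has already vanished, so the bump equals
    \<open>step\<close> there, which is at least its value at 1/2.\<close>
  have "step (1 / 2) \<le> bump u" if "u \<in> {0..1 / 2}" for u
    using antimonoD[OF antimono_step, of u "1 / 2"] that by (simp add: bump_def step_right)
  with pos show "\<exists>a b c. a < b \<and> 0 < c \<and> (\<forall>u\<in>{a..b}. c \<le> bump u)"
    by - (rule exI[of _ 0], rule exI[of _ "1 / 2"], rule exI[of _ "step (1 / 2)"], simp)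
  have "antimono (\<lambda>u. step (u + 1))"
    using antimono_step by (simp add: antimono_def)
  then show "\<exists>\<eta>1 \<eta>2. antimono \<eta>1 \<and> antimono \<eta>2 \<and> (\<forall>u. 0 \<le> \<eta>1 u \<and> \<eta>1 u \<le> 1 \<and> 0 \<le> \<eta>2 u \<and> \<eta>2 u \<le> 1) \<and>
        (\<forall>u. bump u = \<eta>1 u - \<eta>2 u)"
    using antimono_step step_bounds by - (rule exI[of _ step], rule exI[of _ "\<lambda>u. step (u + 1)"], simp add: bump_def)
qed

theorem theorem3p4:
  fixes M :: "'w measure"
    and W :: "real \<Rightarrow> 'w \<Rightarrow> real"
    and c T :: real
    and X :: "real ^ 3 \<Rightarrow> real \<Rightarrow> 'w \<Rightarrow> real ^ 3"
  assumes "prob_space M"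
    and "standard_brownian_motion M W"
    and "0 < c" and "0 < T"
    and "\<And>x. sde_solution M W drift diffusion x (X x)"
  shows "(\<forall>t>0. (\<forall>x. integrable M (X x t)) \<and>
            (\<forall>U. open U \<and> U \<noteq> {} \<longrightarrow>
               continuous_on U (\<lambda>x. \<integral>\<omega>. X x t \<omega> \<partial>M) \<and>
               \<not> locally_holder_continuous_on U (\<lambda>x. \<integral>\<omega>. X x t \<omega> \<partial>M))) \<and>
         (\<exists>\<phi> :: real ^ 3 \<Rightarrow> real. infinitely_differentiable \<phi> \<and> has_compact_support \<phi> \<and>
            (\<forall>t. 0 < t \<and> t \<le> T \<longrightarrow>
               (\<forall>U. open U \<and> U \<noteq> {} \<and> U \<subseteq> {x. \<forall>i. - c < x $ i \<and> x $ i < c} \<longrightarrow>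
                  continuous_on U (\<lambda>x. \<integral>\<omega>. \<phi> (X x t \<omega>) \<partial>M) \<and>
                  \<not> locally_holder_continuous_on U (\<lambda>x. \<integral>\<omega>. \<phi> (X x t \<omega>) \<partial>M))))"
proof -
  interpret prob_space M by fact
  \<comment> \<open>The noise is read off the solution started at 0, whose paths are continuous for
    every \<omega>, while those of \<open>W\<close> are so only almost surely. Joint measurability
    then follows, and \<open>V\<close> agrees with the increments of \<open>W\<close> off one null
    set.\<close>
  define V where "V s \<omega> = X 0 (max 0 s) \<omega> $ 2" for s \<omega>
  have X_meas: "X x t \<in> borel_measurable M" if "0 \<le> t" for x t
    using assms(5)[of x] that unfolding sde_solution_def by blast
  have X_comp: "(\<lambda>\<omega>. X x t \<omega> $ i) \<in> borel_measurable M" if "0 \<le> t" for x t i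
    by (rule borel_measurable_continuous_on[OF linear_continuous_on[OF bounded_linear_vec_nth] X_meas[OF that]])
  have X_cont: "continuous_on {0..} (\<lambda>t. X x t \<omega> $ i)" if "\<omega> \<in> space M" for x \<omega> i
  proof -
    have "continuous_on {0..} (\<lambda>t. X x t \<omega>)"
      using assms(5)[of x] that unfolding sde_solution_def by blast
    then show ?thesis by (rule continuous_on_component)
  qed
  have V_meas: "(\<lambda>(s, \<omega>). V s \<omega>) \<in> borel_measurable (borel \<Otimes>\<^sub>M M)"
    unfolding V_def by (rule jointly_measurable_continuous_paths[OF X_comp X_cont])
  have VW: "AE \<omega> in M. \<forall>t\<ge>0. V t \<omega> = W t \<omega> - W 0 \<omega>"
    using sde_solution_components[OF assms(5)[of 0]] by eventually_elim (simp add: V_def)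
  have W_meas: "W t \<in> borel_measurable M" if "0 \<le> t" for t
    using assms(2) that unfolding standard_brownian_motion_def by blast
  have V_meas1: "V t \<in> borel_measurable M" for t
    unfolding V_def by (rule X_comp) simp
  interpret gaussian_increments M V
  proof
    show "(\<lambda>(s, \<omega>). V s \<omega>) \<in> borel_measurable (borel \<Otimes>\<^sub>M M)" by (rule V_meas)
    fix s t :: real assume st: "0 < s" "s < t"
    have [measurable]: "W 0 \<in> borel_measurable M" "W s \<in> borel_measurable M" "W t \<in> borel_measurable M"
      using st by (simp_all add: W_meas)
    note [measurable] = V_meas1
    have "distr M (borel \<Otimes>\<^sub>M borel) (\<lambda>\<omega>. (V s \<omega>, V t \<omega> - V s \<omega>)) =
        distr M (borel \<Otimes>\<^sub>M borel) (\<lambda>\<omega>. (W s \<omega> - W 0 \<omega>, W t \<omega> - W s \<omega>))"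
    proof (rule distr_cong_AE)
      show "AE \<omega> in M. (V s \<omega>, V t \<omega> - V s \<omega>) = (W s \<omega> - W 0 \<omega>, W t \<omega> - W s \<omega>)"
        using VW by eventually_elim (use st in simp)
    qed measurable
    then show "distr M (borel \<Otimes>\<^sub>M borel) (\<lambda>\<omega>. (V s \<omega>, V t \<omega> - V s \<omega>)) = gauss s \<Otimes>\<^sub>M gauss (t - s)"
      using brownian_increment_law[OF assms(2) st] by simp
  qed
  define I where "I x t \<omega> = (\<integral>s. drift1 (x $ 2 + V s \<omega>) (x $ 3) \<partial>interval_measure t)" for x :: "real ^ 3" and t \<omega>
  have X_eq: "AE \<omega> in M. X x t \<omega> $ 1 = x $ 1 + I x t \<omega> \<and> X x t \<omega> $ 2 = x $ 2 + V t \<omega> \<and> X x t \<omega> $ 3 = x $ 3"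
    if t: "0 < t" for x t
    using sde_solution_components[OF assms(5)[of x]] VW AE_space
  proof eventually_elim
    case (elim \<omega>)
    have eq2: "X x s \<omega> $ 2 = x $ 2 + V s \<omega>" and eq3: "X x s \<omega> $ 3 = x $ 3" if "0 \<le> s" for s
      using elim that by simp_all
    have [measurable]: "(\<lambda>s. V s \<omega>) \<in> borel_measurable borel"
      using measurable_V[of "\<lambda>s. s" borel "\<lambda>_. \<omega>"] elim(3) by simp
    have "(LINT s:{0..t}|lborel. drift1 (X x s \<omega> $ 2) (X x s \<omega> $ 3)) =
        (LINT s:{0..t}|lborel. drift1 (x $ 2 + V s \<omega>) (x $ 3))"
      by (rule set_lebesgue_integral_cong) (auto simp: eq2 eq3)
    also have "\<dots> = I x t \<omega>"
      unfolding I_def by (rule set_integral_Icc_eq_interval_measure) simp_all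
    finally show ?case
      using elim(1) t eq2[of t] eq3[of t] by simp
  qed
  have I_bound: "\<bar>I x t \<omega>\<bar> \<le> t * drift_bound" if t: "0 < t" for x t \<omega>
  proof -
    interpret T: finite_measure "interval_measure t" by (rule finite_interval_measure)
    have "\<bar>I x t \<omega>\<bar> \<le> (\<integral>s. \<bar>drift1 (x $ 2 + V s \<omega>) (x $ 3)\<bar> \<partial>interval_measure t)"
      unfolding I_def by (rule integral_abs_bound)
    also have "\<dots> \<le> (\<integral>s. drift_bound \<partial>interval_measure t)"
      by (rule integral_mono') (simp_all add: abs_drift1_le drift_bound_nonneg)
    also have "\<dots> = t * drift_bound"
      using t by (simp add: space_restrict_space measure_restrict_space)
    finally show ?thesis .
  qed
  have mean: "expectation (\<lambda>\<omega>. X x t \<omega> $ 1 * \<psi> (X x t \<omega> $ 2)) = weighted_mean \<psi> t (x $ 1) (x $ 2) (x $ 3)"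
    if t: "0 < t" and \<psi>: "cutoff \<psi>" for x t \<psi>
  proof -
    note [measurable] = cutoffD(2)[OF \<psi>] X_comp[OF less_imp_le[OF t], of x]
    have [measurable]: "(\<lambda>\<omega>. I x t \<omega>) \<in> borel_measurable M"
    proof -
      have "(\<lambda>\<omega>. \<integral>s. (\<lambda>p. drift1 (x $ 2 + V (fst p) (snd p)) (x $ 3)) (s, \<omega>) \<partial>interval_measure t) \<in> borel_measurable M"
        by (rule borel_measurable_integrable, rule integral_time_product_snd(2)[OF _ abs_drift1_le]) measurable
      then show ?thesis by (simp add: I_def)
    qed
    have "expectation (\<lambda>\<omega>. X x t \<omega> $ 1 * \<psi> (X x t \<omega> $ 2)) = expectation (\<lambda>\<omega>. (x $ 1 + I x t \<omega>) * \<psi> (x $ 2 + V t \<omega>))"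
      by (rule integral_cong_AE, measurable) (use X_eq[OF t, of x] in \<open>eventually_elim, simp\<close>)
    then show ?thesis
      by (simp add: weighted_mean_eq_expectation[OF \<psi>] I_def)
  qed
  have X_int: "integrable M (\<lambda>\<omega>. X x t \<omega> $ i)" if t: "0 < t" for x t i
  proof -
    note [measurable] = X_comp[OF less_imp_le[OF t], of x]
    have 1: "integrable M (\<lambda>\<omega>. X x t \<omega> $ 1)"
    proof (rule integrable_const_bound[where B = "\<bar>x $ 1\<bar> + t * drift_bound"])
      show "AE \<omega> in M. norm (X x t \<omega> $ 1) \<le> \<bar>x $ 1\<bar> + t * drift_bound"
        using X_eq[OF t, of x] by eventually_elim (use I_bound[OF t, of x] in \<open>simp add: order_trans[OF abs_triangle_ineq]\<close>)
    qed measurable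
    \<comment> \<open>The first and third components are almost surely bounded; the second is
      Gaussian, and its integrability comes from the first moment.\<close>
    have 2: "integrable M (\<lambda>\<omega>. X x t \<omega> $ 2)"
    proof -
      have D: "distributed M lborel (\<lambda>\<omega>. W t \<omega> - W 0 \<omega>) (normal_density 0 (sqrt (t - 0)))"
        using assms(2) t unfolding standard_brownian_motion_def by blast
      have "integrable M (\<lambda>\<omega>. W t \<omega> - W 0 \<omega>)"
        using distributed_integrable[OF D, of "\<lambda>u. u"] integrable_normal_moment_nz_1[of "sqrt t" 0] t by simp
      then have i: "integrable M (\<lambda>\<omega>. x $ 2 + (W t \<omega> - W 0 \<omega>))"
        by simp
      have e: "AE \<omega> in M. x $ 2 + (W t \<omega> - W 0 \<omega>) = X x t \<omega> $ 2"
        using X_eq[OF t, of x] VW by eventually_elim (use t in simp)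
      show ?thesis
        by (rule integrable_cong_AE_imp[OF i _ e]) measurable
    qed
    have 3: "integrable M (\<lambda>\<omega>. X x t \<omega> $ 3)"
    proof (rule integrable_const_bound[where B = "\<bar>x $ 3\<bar>"])
      show "AE \<omega> in M. norm (X x t \<omega> $ 3) \<le> \<bar>x $ 3\<bar>"
        using X_eq[OF t, of x] by eventually_elim simp
    qed measurable
    show ?thesis using exhaust_3[of i] 1 2 3 by blast
  qed
  have X_integrable: "integrable M (X x t)" if t: "0 < t" for x t
  proof (rule Bochner_Integration.integrable_bound)
    show "integrable M (\<lambda>\<omega>. \<Sum>i\<in>UNIV. \<bar>X x t \<omega> $ i\<bar>)"
      by (intro Bochner_Integration.integrable_sum integrable_abs X_int[OF t])
    show "X x t \<in> borel_measurable M" using X_meas t by simp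
    show "AE \<omega> in M. norm (X x t \<omega>) \<le> norm (\<Sum>i\<in>UNIV. \<bar>X x t \<omega> $ i\<bar>)"
      by (intro AE_I2) (simp add: norm_le_l1_cart sum_nonneg)
  qed
  have part1: "continuous_on U (\<lambda>x. \<integral>\<omega>. X x t \<omega> \<partial>M) \<and> \<not> locally_holder_continuous_on U (\<lambda>x. \<integral>\<omega>. X x t \<omega> \<partial>M)"
    if t: "0 < t" and U: "open U" "U \<noteq> {}" for t and U :: "(real ^ 3) set"
  proof
    define H where "H x = weighted_mean (\<lambda>_. 1) t (x $ 1) (x $ 2) (x $ 3)" for x :: "real ^ 3"
    have comp: "(\<integral>\<omega>. X x t \<omega> \<partial>M) $ i = expectation (\<lambda>\<omega>. X x t \<omega> $ i)" for x i
      using integral_bounded_linear[OF bounded_linear_vec_nth X_integrable[OF t]] by simp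
    have c1: "(\<integral>\<omega>. X x t \<omega> \<partial>M) $ 1 = H x" for x
      using mean[OF t cutoff_one, of x] by (simp add: comp H_def)
    have c2: "(\<integral>\<omega>. X x t \<omega> \<partial>M) $ 2 = x $ 2 + expectation (\<lambda>\<omega>. X 0 t \<omega> $ 2)" for x
    proof -
      have "expectation (\<lambda>\<omega>. X x t \<omega> $ 2) = expectation (\<lambda>\<omega>. x $ 2 + X 0 t \<omega> $ 2)"
      proof (rule integral_cong_AE)
        show "AE \<omega> in M. X x t \<omega> $ 2 = x $ 2 + X 0 t \<omega> $ 2"
          using X_eq[OF t, of x] X_eq[OF t, of 0] by eventually_elim simp
      qed (use X_comp t in \<open>auto intro!: borel_measurable_add\<close>)
      then show ?thesis
        using X_int[OF t, of 0 2] by (simp add: comp prob_space)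
    qed
    have c3: "(\<integral>\<omega>. X x t \<omega> \<partial>M) $ 3 = x $ 3" for x
    proof -
      have "expectation (\<lambda>\<omega>. X x t \<omega> $ 3) = expectation (\<lambda>\<omega>. x $ 3)"
      proof (rule integral_cong_AE)
        show "AE \<omega> in M. X x t \<omega> $ 3 = x $ 3"
          using X_eq[OF t, of x] by eventually_elim simp
      qed (use X_comp t in auto)
      then show ?thesis by (simp add: comp prob_space)
    qed
    \<comment> \<open>The second and third coordinates of the mean are translations of those of x,
      so only \<open>H\<close> in the first coordinate remains to be examined.\<close>
    have "(\<lambda>x. \<integral>\<omega>. X x t \<omega> \<partial>M) =
        (\<lambda>x. x + (H x - x $ 1) *\<^sub>R axis 1 1 + expectation (\<lambda>\<omega>. X 0 t \<omega> $ 2) *\<^sub>R axis 2 1)"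
      by (rule ext) (simp add: vec_eq_iff forall_3 c1 c2 c3 axis_def)
    moreover have "continuous_on U H"
      unfolding H_def[abs_def] using continuous_weighted_mean[OF cutoff_one] by (rule continuous_on_subset) simp
    ultimately show "continuous_on U (\<lambda>x. \<integral>\<omega>. X x t \<omega> \<partial>M)"
      by (simp only:) (intro continuous_intros)
    show "\<not> locally_holder_continuous_on U (\<lambda>x. \<integral>\<omega>. X x t \<omega> \<partial>M)"
    proof
      assume "locally_holder_continuous_on U (\<lambda>x. \<integral>\<omega>. X x t \<omega> \<partial>M)"
      then have "locally_holder_continuous_on U H"
        by (rule locally_holder_continuous_on_contract) (simp add: c1[symmetric] dist_vec_nth_le)
      then show False
        using weighted_mean_not_locally_holder[OF t cutoff_one U] by (simp add: H_def[abs_def])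
    qed
  qed
  \<comment> \<open>For a start in the cube and t \<le> T the first component stays within c + T
    times the drift bound, and the third stays at x3, within c. The choice involves neither t nor
    U.\<close>
  define \<phi> where "\<phi> = test_function (c + T * drift_bound) c"
  have part2: "continuous_on U (\<lambda>x. \<integral>\<omega>. \<phi> (X x t \<omega>) \<partial>M) \<and> \<not> locally_holder_continuous_on U (\<lambda>x. \<integral>\<omega>. \<phi> (X x t \<omega>) \<partial>M)"
    if t: "0 < t" "t \<le> T" and U: "open U" "U \<noteq> {}" "U \<subseteq> {x. \<forall>i. - c < x $ i \<and> x $ i < c}"
    for t and U :: "(real ^ 3) set"
  proof
    define H where "H x = weighted_mean bump t (x $ 1) (x $ 2) (x $ 3)" for x :: "real ^ 3"
    have eq: "(\<integral>\<omega>. \<phi> (X x t \<omega>) \<partial>M) = H x" if "x \<in> U" for x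
    proof -
      have x: "\<bar>x $ i\<bar> \<le> c" for i
        using that U(3) by (auto simp: abs_le_iff less_imp_le minus_le_iff)
      have "expectation (\<lambda>\<omega>. \<phi> (X x t \<omega>)) = expectation (\<lambda>\<omega>. X x t \<omega> $ 1 * bump (X x t \<omega> $ 2))"
      proof (rule integral_cong_AE)
        show "AE \<omega> in M. \<phi> (X x t \<omega>) = X x t \<omega> $ 1 * bump (X x t \<omega> $ 2)"
          using X_eq[OF t(1), of x]
        proof eventually_elim
          case (elim \<omega>)
          have "\<bar>X x t \<omega> $ 1\<bar> \<le> c + T * drift_bound"
          proof -
            have "\<bar>X x t \<omega> $ 1\<bar> \<le> \<bar>x $ 1\<bar> + \<bar>I x t \<omega>\<bar>"
              using elim abs_triangle_ineq by simp
            also have "\<dots> \<le> c + t * drift_bound"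
              by (intro add_mono x I_bound t)
            also have "\<dots> \<le> c + T * drift_bound"
              using t(2) drift_bound_nonneg by (intro add_left_mono mult_right_mono)
            finally show ?thesis .
          qed
          then show ?case
            using elim x[of 3] by (simp add: \<phi>_def test_function_def plateau_inside)
        qed
        show "(\<lambda>\<omega>. \<phi> (X x t \<omega>)) \<in> borel_measurable M"
        proof (rule borel_measurable_continuous_on[OF _ X_meas])
          have "times_cont_diff 0 \<phi>"
            using infinitely_differentiable_test_function unfolding \<phi>_def infinitely_differentiable_def by blast
          then show "continuous_on UNIV \<phi>" by simp
        qed (use t in simp)
        note [measurable] = X_comp[OF less_imp_le[OF t(1)], of x] cutoffD(2)[OF cutoff_bump]
        show "(\<lambda>\<omega>. X x t \<omega> $ 1 * bump (X x t \<omega> $ 2)) \<in> borel_measurable M"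
          by measurable
      qed
      then show ?thesis
        using mean[OF t(1) cutoff_bump, of x] by (simp add: H_def)
    qed
    have "continuous_on U H"
      unfolding H_def[abs_def] using continuous_weighted_mean[OF cutoff_bump] by (rule continuous_on_subset) simp
    then show "continuous_on U (\<lambda>x. \<integral>\<omega>. \<phi> (X x t \<omega>) \<partial>M)"
      by (rule continuous_on_eq) (simp add: eq)
    show "\<not> locally_holder_continuous_on U (\<lambda>x. \<integral>\<omega>. \<phi> (X x t \<omega>) \<partial>M)"
    proof
      assume "locally_holder_continuous_on U (\<lambda>x. \<integral>\<omega>. \<phi> (X x t \<omega>) \<partial>M)"
      then have "locally_holder_continuous_on U H"
        by (rule locally_holder_continuous_on_contract) (simp add: eq)
      then show False
        using weighted_mean_not_locally_holder[OF t(1) cutoff_bump U(1,2)] by (simp add: H_def[abs_def])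
    qed
  qed
  show ?thesis
  proof (intro conjI exI[of _ \<phi>] allI impI)
    show "infinitely_differentiable \<phi>" "has_compact_support \<phi>"
      unfolding \<phi>_def by (rule infinitely_differentiable_test_function has_compact_support_test_function)+
  qed (use X_integrable part1 part2 in blast)+
qed

end
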